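(* For all integers $m\ge 1$ and $\lambda\in\mathbb Z$, the following identities hold in $\dot{\mathbf U}$: \[ \mathfrak t_{\mathrm{ev}}^{(2m)}\mathbf 1_{2\lambda} = \sum_{c=0}^m \sum_{a=0}^{2m-2c} q^{2(a+c)(m-a-\lambda)-2ac-\binom{2c+1}{2}} \begin{bmatrix} m-c-a-\lambda\\ c\end{bmatrix}_{q^2} E^{(a)} F^{(2m-2c-a)}\mathbf 1_{2\lambda}, \] \[ \mathfrak t_{\mathrm{ev}}^{(2m-1)}\mathbf 1_{2\lambda} = \sum_{c=0}^{m-1} \sum_{a=0}^{2m-1-2c} q^{2(a+c)(m-a-\lambda)-2ac-a-\binom{2c+1}{2}} \begin{bmatrix} m-c-a-\lambda-1\\ c\end{bmatrix}_{q^2} E^{(a)} F^{(2m-1-2c-a)}\mathbf 1_{2\lambda}. \] In particular, $\mathfrak t_{\mathrm{ev}}^{(n)}\mathbf 1_{2\lambda}\in {}_{\mathcal A}\dot{\mathbf U}_{\mathrm{ev}}$ for all $n\in\mathbb N$.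
   Context: $\mathbb N=\{0,1,2,\dots\}$, $\mathcal A=\mathbb Z[q,q^{-1}]$. $\mathbf U=\mathbf U_q(\mathfrak{sl}_2)$ is the $\mathbb Q(q)$-algebra generated by $E,F,K,K^{-1}$ with relations $KK^{-1}=K^{-1}K=1$, $EF-FE=\frac{K-K^{-1}}{q-q^{-1}}$, $KE=q^2EK$, $KF=q^{-2}FK$. For $n\in\mathbb Z$, $[n]=\frac{q^n-q^{-n}}{q-q^{-1}}$, $[n]!=[1]\cdots[n]$ for $n\ge 0$; $E^{(n)}=E^n/[n]!$, $F^{(n)}=F^n/[n]!$. For $m\in\mathbb Z$, $b\in\mathbb N$, $\begin{bmatrix} m\\ b\end{bmatrix}_{q^2}=\prod_{1\le i\le b}\frac{q^{2(m-i+1)}-q^{-2(m-i+1)}}{q^{2i}-q^{-2i}}$. In exponents, $\binom{x}{2}=x(x-1)/2$. Put $\check E=q^{-1}EK^{-1}$ and $\mathfrak t=\check E+F$. The $\imath$-divided powers are $\mathfrak t_{\mathrm{ev}}^{(0)}=1$, $\mathfrak t_{\mathrm{ev}}^{(2a)}=\frac{1}{[2a]!}\,\mathfrak t\prod_{i=1-a}^{a-1}(\mathfrak t-[2i])$ for $a\ge 1$, and $\mathfrak t_{\mathrm{ev}}^{(2a+1)}=\frac{1}{[2a+1]!}\prod_{i=-a}^{a}(\mathfrak t-[2i])$ for $a\ge 0$. $\dot{\mathbf U}$ is the modified quantum group: the $\mathbb Q(q)$-algebra generated by $E\mathbf 1_\lambda$, $F\mathbf 1_\lambda$ and idempotents $\mathbf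 1_\lambda$ ($\lambda\in\mathbb Z$) with relations $\mathbf 1_\lambda\mathbf 1_\mu=\delta_{\lambda,\mu}\mathbf 1_\lambda$, $E\mathbf 1_\lambda=\mathbf 1_{\lambda+2}E\mathbf 1_\lambda=\mathbf 1_{\lambda+2}E$, $F\mathbf 1_\lambda=\mathbf 1_{\lambda-2}F\mathbf 1_\lambda=\mathbf 1_{\lambda-2}F$, $EF\mathbf 1_\lambda-FE\mathbf 1_\lambda=[\lambda]\mathbf 1_\lambda$. $\mathbf U$ acts naturally on $\dot{\mathbf U}$ from the left, with $K\mathbf 1_\lambda=q^\lambda\mathbf 1_\lambda$. ${}_{\mathcal A}\dot{\mathbf U}$ is the $\mathcal A$-subalgebra of $\dot{\mathbf U}$ generated by $E^{(n)}\mathbf 1_\lambda$, $F^{(n)}\mathbf 1_\lambda$, $\mathbf 1_\lambda$ ($n\ge 0$, $\lambda\in\mathbb Z$), and ${}_{\mathcal A}\dot{\mathbf U}_{\mathrm{ev}}=\bigoplus_{\lambda\in\mathbb Z}{}_{\mathcal A}\dot{\mathbf U}\,\mathbf 1_{2\lambda}$. *)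

theory Defs
  imports
    "HOL-Computational_Algebra.Polynomial"
    "HOL-Computational_Algebra.Fraction_Field"
    "HOL-Library.Groups_Big_Fun"
begin

section \<open>The field of rational functions and quantum integers\<close>

type_synonym ratfun = "rat poly fract"

definition qv :: ratfun
  where "qv = Fract [:0, 1:] 1"

definition qint :: "int \<Rightarrow> ratfun"
  where "qint n = (qv powi n - qv powi (- n)) / (qv - inverse qv)"

definition qfact :: "nat \<Rightarrow> ratfun"
  where "qfact n = (\<Prod>i = 1..n. qint (int i))"

text \<open>The quantum binomial coefficient in \<open>q\<^sup>2\<close>, with an arbitrary integer on top.\<close>

definition qbinom2 :: "int \<Rightarrow> nat \<Rightarrow> ratfun"
  where "qbinom2 m b =
    (\<Prod>i = 1..b. (qv powi (2 * (m - int i + 1)) - qv powi (- 2 * (m - int i + 1))) /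
                 (qv powi (2 * int i) - qv powi (- 2 * int i)))"

definition binom2 :: "int \<Rightarrow> int"
  where "binom2 x = x * (x - 1) div 2"

definition laurent_ring :: "ratfun set"
  where "laurent_ring = {(\<Sum>i\<in>I. of_int (c i) * qv powi i) | (I :: int set) (c :: int \<Rightarrow> int). finite I}"

lemma qv_nonzero [simp]: "qv \<noteq> 0"
  by (simp add: qv_def Zero_fract_def eq_fract)


section \<open>Associative algebras given by generators and relations\<close>

text \<open>
  An algebra over the rational functions presented by generators and relations is the quotient of
  the set of formal expressions by the smallest congruence containing the axioms of associative
  algebras and the given relations. The expressions have no unit, since the modified quantum group
  is not unital; a unit, if wanted, is a further generator subject to the unit laws.
\<close>

datatype 'g expr =
    Gen 'g
  | Zero
  | Plus "'g expr" "'g expr"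
  | Times "'g expr" "'g expr"
  | Scale ratfun "'g expr"

abbreviation Minus :: "'g expr \<Rightarrow> 'g expr \<Rightarrow> 'g expr"
  where "Minus x y \<equiv> Plus x (Scale (- 1) y)"

inductive alg_cong :: "('g expr \<Rightarrow> 'g expr \<Rightarrow> bool) \<Rightarrow> 'g expr \<Rightarrow> 'g expr \<Rightarrow> bool"
  for R :: "'g expr \<Rightarrow> 'g expr \<Rightarrow> bool"
  where
    rel: "R x y \<Longrightarrow> alg_cong R x y"
  | refl: "alg_cong R x x"
  | sym: "alg_cong R x y \<Longrightarrow> alg_cong R y x"
  | trans: "alg_cong R x y \<Longrightarrow> alg_cong R y z \<Longrightarrow> alg_cong R x z"
  | plus_cong: "alg_cong R x x' \<Longrightarrow> alg_cong R y y' \<Longrightarrow> alg_cong R (Plus x y) (Plus x' y')"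
  | times_cong: "alg_cong R x x' \<Longrightarrow> alg_cong R y y' \<Longrightarrow> alg_cong R (Times x y) (Times x' y')"
  | scale_cong: "alg_cong R x x' \<Longrightarrow> alg_cong R (Scale k x) (Scale k x')"
  | plus_assoc: "alg_cong R (Plus (Plus x y) z) (Plus x (Plus y z))"
  | plus_comm: "alg_cong R (Plus x y) (Plus y x)"
  | plus_zero: "alg_cong R (Plus Zero x) x"
  | plus_neg: "alg_cong R (Minus x x) Zero"
  | scale_one: "alg_cong R (Scale 1 x) x"
  | scale_scale: "alg_cong R (Scale k (Scale l x)) (Scale (k * l) x)"
  | scale_add_left: "alg_cong R (Scale (k + l) x) (Plus (Scale k x) (Scale l x))"
  | scale_add_right: "alg_cong R (Scale k (Plus x y)) (Plus (Scale k x) (Scale k y))"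
  | times_assoc: "alg_cong R (Times (Times x y) z) (Times x (Times y z))"
  | times_add_left: "alg_cong R (Times (Plus x y) z) (Plus (Times x z) (Times y z))"
  | times_add_right: "alg_cong R (Times x (Plus y z)) (Plus (Times x y) (Times x z))"
  | scale_times_left: "alg_cong R (Times (Scale k x) y) (Scale k (Times x y))"
  | scale_times_right: "alg_cong R (Times x (Scale k y)) (Scale k (Times x y))"

lemma equivp_alg_cong: "equivp (alg_cong R)"
  by (rule equivpI)
     (auto intro: reflpI sympI transpI alg_cong.refl alg_cong.sym alg_cong.trans)


section \<open>The quantum group of \<open>sl\<^sub>2\<close>\<close>

datatype uq_gen = gOne | gE | gF | gK | gKinv

inductive uq_rel :: "uq_gen expr \<Rightarrow> uq_gen expr \<Rightarrow> bool"
  where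
    unit_left: "uq_rel (Times (Gen gOne) x) x"
  | unit_right: "uq_rel (Times x (Gen gOne)) x"
  | K_Kinv: "uq_rel (Times (Gen gK) (Gen gKinv)) (Gen gOne)"
  | Kinv_K: "uq_rel (Times (Gen gKinv) (Gen gK)) (Gen gOne)"
  | E_F: "uq_rel (Minus (Times (Gen gE) (Gen gF)) (Times (Gen gF) (Gen gE)))
                 (Scale (1 / (qv - inverse qv)) (Minus (Gen gK) (Gen gKinv)))"
  | K_E: "uq_rel (Times (Gen gK) (Gen gE)) (Scale (qv powi 2) (Times (Gen gE) (Gen gK)))"
  | K_F: "uq_rel (Times (Gen gK) (Gen gF)) (Scale (qv powi (- 2)) (Times (Gen gF) (Gen gK)))"

quotient_type Uq = "uq_gen expr" / "alg_cong uq_rel"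
  by (rule equivp_alg_cong)

lift_definition scale_U :: "ratfun \<Rightarrow> Uq \<Rightarrow> Uq" (infixr \<open>*\<^sub>U\<close> 75) is Scale
  by (rule alg_cong.scale_cong)

lift_definition U_E :: Uq is "Gen gE" .
lift_definition U_F :: Uq is "Gen gF" .
lift_definition U_K :: Uq is "Gen gK" .
lift_definition U_Kinv :: Uq is "Gen gKinv" .

text \<open>The counit; it shows that the quantum group is not the zero ring.\<close>

primrec counit_expr :: "uq_gen expr \<Rightarrow> ratfun"
  where
    "counit_expr (Gen g) = (case g of gE \<Rightarrow> 0 | gF \<Rightarrow> 0 | _ \<Rightarrow> 1)"
  | "counit_expr Zero = 0"
  | "counit_expr (Plus x y) = counit_expr x + counit_expr y"
  | "counit_expr (Times x y) = counit_expr x * counit_expr y"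
  | "counit_expr (Scale k x) = k * counit_expr x"

lemma counit_expr_cong: "alg_cong uq_rel x y \<Longrightarrow> counit_expr x = counit_expr y"
proof (induction rule: alg_cong.induct)
  case (rel x y)
  then show ?case by (induction rule: uq_rel.induct) simp_all
qed (simp_all add: algebra_simps)

instantiation Uq :: ring_1
begin

lift_definition zero_Uq :: Uq is Zero .
lift_definition one_Uq :: Uq is "Gen gOne" .
lift_definition plus_Uq :: "Uq \<Rightarrow> Uq \<Rightarrow> Uq" is Plus by (rule alg_cong.plus_cong)
lift_definition times_Uq :: "Uq \<Rightarrow> Uq \<Rightarrow> Uq" is Times by (rule alg_cong.times_cong)
lift_definition uminus_Uq :: "Uq \<Rightarrow> Uq" is "Scale (- 1)" by (rule alg_cong.scale_cong)
lift_definition minus_Uq :: "Uq \<Rightarrow> Uq \<Rightarrow> Uq" is Minus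
  by (intro alg_cong.plus_cong alg_cong.scale_cong)

instance
proof
  fix a b c :: Uq
  show "a + b + c = a + (b + c)" by transfer (rule alg_cong.plus_assoc)
  show "a + b = b + a" by transfer (rule alg_cong.plus_comm)
  show "0 + a = a" by transfer (rule alg_cong.plus_zero)
  show "- a + a = 0" by transfer (meson alg_cong.plus_comm alg_cong.plus_neg alg_cong.trans)
  show "a - b = a + - b" by transfer (rule alg_cong.refl)
  show "a * b * c = a * (b * c)" by transfer (rule alg_cong.times_assoc)
  show "(a + b) * c = a * c + b * c" by transfer (rule alg_cong.times_add_left)
  show "a * (b + c) = a * b + a * c" by transfer (rule alg_cong.times_add_right)
  show "1 * a = a" by transfer (intro alg_cong.rel uq_rel.intros)
  show "a * 1 = a" by transfer (intro alg_cong.rel uq_rel.intros)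
  have "\<not> alg_cong uq_rel Zero (Gen gOne)"
    using counit_expr_cong[of Zero "Gen gOne"] by auto
  then show "(0 :: Uq) \<noteq> 1" by transfer
qed

end

interpretation Uq: vector_space scale_U
proof
  fix k l :: ratfun and x y :: Uq
  show "k *\<^sub>U (x + y) = k *\<^sub>U x + k *\<^sub>U y" by transfer (rule alg_cong.scale_add_right)
  show "(k + l) *\<^sub>U x = k *\<^sub>U x + l *\<^sub>U x" by transfer (rule alg_cong.scale_add_left)
  show "k *\<^sub>U (l *\<^sub>U x) = (k * l) *\<^sub>U x" by transfer (rule alg_cong.scale_scale)
  show "1 *\<^sub>U x = x" by transfer (rule alg_cong.scale_one)
qed

lemma scale_U_mult_left: "(k *\<^sub>U x) * y = k *\<^sub>U (x * y)"
  by transfer (rule alg_cong.scale_times_left)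

lemma scale_U_mult_right: "x * (k *\<^sub>U y) = k *\<^sub>U (x * y)"
  by transfer (rule alg_cong.scale_times_right)

lemma Uq_relations:
  "U_K * U_Kinv = 1"
  "U_Kinv * U_K = 1"
  "U_E * U_F - U_F * U_E = (1 / (qv - inverse qv)) *\<^sub>U (U_K - U_Kinv)"
  "U_K * U_E = (qv powi 2) *\<^sub>U (U_E * U_K)"
  "U_K * U_F = (qv powi (- 2)) *\<^sub>U (U_F * U_K)"
proof -
  show "U_K * U_Kinv = 1" by transfer (rule alg_cong.rel, rule uq_rel.intros)
  show "U_Kinv * U_K = 1" by transfer (rule alg_cong.rel, rule uq_rel.intros)
  show "U_E * U_F - U_F * U_E = (1 / (qv - inverse qv)) *\<^sub>U (U_K - U_Kinv)"
    by transfer (rule alg_cong.rel, rule uq_rel.intros)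
  show "U_K * U_E = (qv powi 2) *\<^sub>U (U_E * U_K)"
    by transfer (rule alg_cong.rel, rule uq_rel.intros)
  show "U_K * U_F = (qv powi (- 2)) *\<^sub>U (U_F * U_K)"
    by transfer (rule alg_cong.rel, rule uq_rel.intros)
qed

definition U_Ediv :: "nat \<Rightarrow> Uq"
  where "U_Ediv n = (1 / qfact n) *\<^sub>U U_E ^ n"

definition U_Fdiv :: "nat \<Rightarrow> Uq"
  where "U_Fdiv n = (1 / qfact n) *\<^sub>U U_F ^ n"


section \<open>The even \<open>\<iota>\<close>-divided powers\<close>

definition U_Echeck :: Uq
  where "U_Echeck = inverse qv *\<^sub>U (U_E * U_Kinv)"

definition U_t :: Uq
  where "U_t = U_Echeck + U_F"

text \<open>
  The factors commute with one another, so the order of the products (here increasing in \<open>i\<close>)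
  does not matter.
\<close>

definition t_ev :: "nat \<Rightarrow> Uq"
  where "t_ev n =
    (if n = 0 then 1
     else if even n then
       (let a = int (n div 2)
        in (1 / qfact n) *\<^sub>U (U_t * prod_list (map (\<lambda>i. U_t - qint (2 * i) *\<^sub>U 1) [1 - a..a - 1])))
     else
       (let a = int (n div 2)
        in (1 / qfact n) *\<^sub>U prod_list (map (\<lambda>i. U_t - qint (2 * i) *\<^sub>U 1) [- a..a])))"


section \<open>The modified quantum group\<close>

text \<open>\<open>dE l\<close>, \<open>dF l\<close>, \<open>dI l\<close> stand for the generators \<open>E 1\<^sub>l\<close>, \<open>F 1\<^sub>l\<close>, \<open>1\<^sub>l\<close>.\<close>

datatype ud_gen = dE int | dF int | dI int

text \<open>
  The elements \<open>1\<^sub>l\<^sub>+\<^sub>2 E\<close> and \<open>1\<^sub>l\<^sub>-\<^sub>2 F\<close> are other names for \<open>E 1\<^sub>l\<close> and \<open>F 1\<^sub>l\<close>,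
  and \<open>E F 1\<^sub>l\<close> is the product of \<open>E 1\<^sub>l\<^sub>-\<^sub>2\<close> and \<open>F 1\<^sub>l\<close>; likewise for \<open>F E 1\<^sub>l\<close>.
\<close>

inductive ud_rel :: "ud_gen expr \<Rightarrow> ud_gen expr \<Rightarrow> bool"
  where
    I_I: "ud_rel (Times (Gen (dI l)) (Gen (dI m))) (if l = m then Gen (dI l) else Zero)"
  | I_E: "ud_rel (Times (Gen (dI (l + 2))) (Gen (dE l))) (Gen (dE l))"
  | E_I: "ud_rel (Times (Gen (dE l)) (Gen (dI l))) (Gen (dE l))"
  | I_F: "ud_rel (Times (Gen (dI (l - 2))) (Gen (dF l))) (Gen (dF l))"
  | F_I: "ud_rel (Times (Gen (dF l)) (Gen (dI l))) (Gen (dF l))"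
  | E_F: "ud_rel (Minus (Times (Gen (dE (l - 2))) (Gen (dF l))) (Times (Gen (dF (l + 2))) (Gen (dE l))))
                 (Scale (qint l) (Gen (dI l)))"

quotient_type Udot = "ud_gen expr" / "alg_cong ud_rel"
  by (rule equivp_alg_cong)

lift_definition scale_D :: "ratfun \<Rightarrow> Udot \<Rightarrow> Udot" (infixr \<open>*\<^sub>D\<close> 75) is Scale
  by (rule alg_cong.scale_cong)

lift_definition D_E :: "int \<Rightarrow> Udot" is "\<lambda>l. Gen (dE l)" .
lift_definition D_F :: "int \<Rightarrow> Udot" is "\<lambda>l. Gen (dF l)" .
lift_definition D_one :: "int \<Rightarrow> Udot" is "\<lambda>l. Gen (dI l)" .

instantiation Udot :: ring
begin

lift_definition zero_Udot :: Udot is Zero .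
lift_definition plus_Udot :: "Udot \<Rightarrow> Udot \<Rightarrow> Udot" is Plus by (rule alg_cong.plus_cong)
lift_definition times_Udot :: "Udot \<Rightarrow> Udot \<Rightarrow> Udot" is Times by (rule alg_cong.times_cong)
lift_definition uminus_Udot :: "Udot \<Rightarrow> Udot" is "Scale (- 1)" by (rule alg_cong.scale_cong)
lift_definition minus_Udot :: "Udot \<Rightarrow> Udot \<Rightarrow> Udot" is Minus
  by (intro alg_cong.plus_cong alg_cong.scale_cong)

instance
proof
  fix a b c :: Udot
  show "a + b + c = a + (b + c)" by transfer (rule alg_cong.plus_assoc)
  show "a + b = b + a" by transfer (rule alg_cong.plus_comm)
  show "0 + a = a" by transfer (rule alg_cong.plus_zero)
  show "- a + a = 0" by transfer (meson alg_cong.plus_comm alg_cong.plus_neg alg_cong.trans)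
  show "a - b = a + - b" by transfer (rule alg_cong.refl)
  show "a * b * c = a * (b * c)" by transfer (rule alg_cong.times_assoc)
  show "(a + b) * c = a * c + b * c" by transfer (rule alg_cong.times_add_left)
  show "a * (b + c) = a * b + a * c" by transfer (rule alg_cong.times_add_right)
qed

end

interpretation Udot: vector_space scale_D
proof
  fix k l :: ratfun and x y :: Udot
  show "k *\<^sub>D (x + y) = k *\<^sub>D x + k *\<^sub>D y" by transfer (rule alg_cong.scale_add_right)
  show "(k + l) *\<^sub>D x = k *\<^sub>D x + l *\<^sub>D x" by transfer (rule alg_cong.scale_add_left)
  show "k *\<^sub>D (l *\<^sub>D x) = (k * l) *\<^sub>D x" by transfer (rule alg_cong.scale_scale)
  show "1 *\<^sub>D x = x" by transfer (rule alg_cong.scale_one)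
qed

lemma scale_D_mult_left: "(k *\<^sub>D x) * y = k *\<^sub>D (x * y)"
  by transfer (rule alg_cong.scale_times_left)

lemma scale_D_mult_right: "x * (k *\<^sub>D y) = k *\<^sub>D (x * y)"
  by transfer (rule alg_cong.scale_times_right)

lemma D_one_one: "D_one l * D_one m = (if l = m then D_one l else 0)"
proof (cases "l = m")
  case True
  have "alg_cong ud_rel (Times (Gen (dI m)) (Gen (dI m))) (Gen (dI m))"
    using alg_cong.rel[of ud_rel, OF ud_rel.I_I[of m m]] by simp
  then have "D_one m * D_one m = D_one m" by transfer
  with True show ?thesis by simp
next
  case False
  then have "alg_cong ud_rel (Times (Gen (dI l)) (Gen (dI m))) Zero"
    using alg_cong.rel[of ud_rel, OF ud_rel.I_I[of l m]] by simp
  then have "D_one l * D_one m = 0" by transfer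
  with False show ?thesis by simp
qed

lemma Udot_relations:
  "D_one (l + 2) * D_E l = D_E l"
  "D_E l * D_one l = D_E l"
  "D_one (l - 2) * D_F l = D_F l"
  "D_F l * D_one l = D_F l"
  "D_E (l - 2) * D_F l - D_F (l + 2) * D_E l = qint l *\<^sub>D D_one l"
proof -
  show "D_one (l + 2) * D_E l = D_E l" by transfer (rule alg_cong.rel, rule ud_rel.I_E)
  show "D_E l * D_one l = D_E l" by transfer (rule alg_cong.rel, rule ud_rel.E_I)
  show "D_one (l - 2) * D_F l = D_F l" by transfer (rule alg_cong.rel, rule ud_rel.I_F)
  show "D_F l * D_one l = D_F l" by transfer (rule alg_cong.rel, rule ud_rel.F_I)
  show "D_E (l - 2) * D_F l - D_F (l + 2) * D_E l = qint l *\<^sub>D D_one l"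
    by transfer (rule alg_cong.rel, rule ud_rel.E_F)
qed

lemma Udot_induct [case_names E F one zero plus times scale]:
  assumes "\<And>l. P (D_E l)" "\<And>l. P (D_F l)" "\<And>l. P (D_one l)" "P 0"
    and "\<And>x y. P x \<Longrightarrow> P y \<Longrightarrow> P (x + y)"
    and "\<And>x y. P x \<Longrightarrow> P y \<Longrightarrow> P (x * y)"
    and "\<And>k x. P x \<Longrightarrow> P (k *\<^sub>D x)"
  shows "P x"
proof -
  have "P (abs_Udot e)" for e
  proof (induction e)
    case (Gen g)
    then show ?case
      using assms(1-3) by (cases g) (simp_all add: D_E_def D_F_def D_one_def)
  next
    case Zero
    then show ?case using assms(4) by (simp add: zero_Udot_def)
  next
    case (Plus e f)
    then show ?case using assms(5) by (simp flip: plus_Udot.abs_eq)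
  next
    case (Times e f)
    then show ?case using assms(6) by (simp flip: times_Udot.abs_eq)
  next
    case (Scale k e)
    then show ?case using assms(7) by (simp flip: scale_D.abs_eq)
  qed
  then show ?thesis by (induction x rule: Udot.abs_induct)
qed


section \<open>The left action on the modified quantum group\<close>

text \<open>
  For \<open>x\<close> in the modified quantum group only finitely many \<open>1\<^sub>l x\<close> are nonzero and \<open>x\<close> is their
  sum. So \<open>E\<close> and \<open>F\<close> act by left multiplication by the formal sums of all \<open>E 1\<^sub>l\<close> and
  \<open>F 1\<^sub>l\<close>, and \<open>K\<close> multiplies \<open>1\<^sub>l x\<close> by \<open>q\<^sup>l\<close>.
\<close>

definition lact :: "(int \<Rightarrow> Udot) \<Rightarrow> Udot \<Rightarrow> Udot"
  where "lact f x = Sum_any (\<lambda>l. f l * x)"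

primrec act_expr :: "uq_gen expr \<Rightarrow> Udot \<Rightarrow> Udot"
  where
    "act_expr (Gen g) =
       (case g of
          gOne \<Rightarrow> (\<lambda>x. x)
        | gE \<Rightarrow> lact D_E
        | gF \<Rightarrow> lact D_F
        | gK \<Rightarrow> lact (\<lambda>l. (qv powi l) *\<^sub>D D_one l)
        | gKinv \<Rightarrow> lact (\<lambda>l. (qv powi (- l)) *\<^sub>D D_one l))"
  | "act_expr Zero = (\<lambda>x. 0)"
  | "act_expr (Plus u v) = (\<lambda>x. act_expr u x + act_expr v x)"
  | "act_expr (Times u v) = (\<lambda>x. act_expr u (act_expr v x))"
  | "act_expr (Scale k u) = (\<lambda>x. k *\<^sub>D act_expr u x)"

lemma finite_D_one_mult: "finite {l. D_one l * x \<noteq> 0}"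
proof (induction x rule: Udot_induct)
  case (E m)
  have "D_one l * D_E m = 0" if "l \<noteq> m + 2" for l
  proof -
    have "D_one l * D_E m = (D_one l * D_one (m + 2)) * D_E m"
      by (simp only: mult.assoc Udot_relations)
    then show ?thesis using that by (simp add: D_one_one)
  qed
  then have "{l. D_one l * D_E m \<noteq> 0} \<subseteq> {m + 2}" by auto
  then show ?case by (rule finite_subset) simp
next
  case (F m)
  have "D_one l * D_F m = 0" if "l \<noteq> m - 2" for l
  proof -
    have "D_one l * D_F m = (D_one l * D_one (m - 2)) * D_F m"
      by (simp only: mult.assoc Udot_relations)
    then show ?thesis using that by (simp add: D_one_one)
  qed
  then have "{l. D_one l * D_F m \<noteq> 0} \<subseteq> {m - 2}" by auto
  then show ?case by (rule finite_subset) simp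
next
  case (one m)
  show ?case by (rule finite_subset[of _ "{m}"]) (auto simp: D_one_one)
next
  case zero
  show ?case by simp
next
  case (plus x y)
  show ?case
    by (rule finite_subset[OF _ finite_UnI[OF plus]]) (auto simp: distrib_left)
next
  case (times x y)
  show ?case
    by (rule finite_subset[OF _ times(1)]) (auto simp: mult.assoc[symmetric])
next
  case (scale k x)
  show ?case
    by (rule finite_subset[OF _ scale]) (auto simp: scale_D_mult_right)
qed

lemma finite_lact:
  assumes "\<And>l. f l * D_one l = f l"
  shows "finite {l. f l * x \<noteq> 0}"
proof (rule finite_subset[OF _ finite_D_one_mult[of x]])
  have "f l * x = f l * (D_one l * x)" for l
    by (simp add: assms mult.assoc[symmetric])
  then show "{l. f l * x \<noteq> 0} \<subseteq> {l. D_one l * x \<noteq> 0}" by force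
qed

definition left_op :: "(Udot \<Rightarrow> Udot) \<Rightarrow> bool"
  where "left_op T \<longleftrightarrow> T 0 = 0 \<and> (\<forall>x y. T (x + y) = T x + T y) \<and> (\<forall>k x. T (k *\<^sub>D x) = k *\<^sub>D T x) \<and>
           (\<forall>x y. T (x * y) = T x * y)"

lemma left_op_lact:
  assumes "\<And>l. f l * D_one l = f l"
  shows "left_op (lact f)"
proof -
  note fin = finite_lact[of f, OF assms]
  have "lact f (x + y) = lact f x + lact f y" for x y
    unfolding lact_def distrib_left by (rule Sum_any.distrib) (rule fin)+
  moreover have "lact f (k *\<^sub>D x) = k *\<^sub>D lact f x" for k x
  proof -
    have "lact f (k *\<^sub>D x) = (\<Sum>l\<in>{l. f l * x \<noteq> 0}. f l * (k *\<^sub>D x))"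
      unfolding lact_def
      by (rule Sum_any.expand_superset[OF fin]) (auto simp: scale_D_mult_right)
    then show ?thesis
      by (simp add: lact_def Sum_any.expand_set scale_D_mult_right Udot.scale_sum_right)
  qed
  moreover have "lact f (x * y) = lact f x * y" for x y
    unfolding lact_def by (subst Sum_any_left_distrib[OF fin]) (simp add: mult.assoc)
  ultimately show ?thesis
    by (simp add: left_op_def) (simp add: lact_def)
qed

lemma lact_D_one:
  assumes "\<And>l. f l * D_one l = f l"
  shows "lact f (D_one m) = f m"
proof -
  have "f l * D_one m = (if l = m then f l else 0)" for l
  proof -
    have "f l * D_one m = f l * (D_one l * D_one m)"
      by (simp add: assms mult.assoc[symmetric])
    then show ?thesis by (simp add: D_one_one assms)
  qed
  then show ?thesis by (simp add: lact_def)
qed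

lemma left_op_eqI:
  assumes "left_op S" "left_op T" "\<And>l. S (D_one l) = T (D_one l)"
  shows "S = T"
proof
  fix x
  show "S x = T x"
  proof (induction x rule: Udot_induct)
    case (E l)
    have "S (D_one (l + 2) * D_E l) = T (D_one (l + 2) * D_E l)"
      using assms by (simp add: left_op_def)
    then show ?case by (simp only: Udot_relations)
  next
    case (F l)
    have "S (D_one (l - 2) * D_F l) = T (D_one (l - 2) * D_F l)"
      using assms by (simp add: left_op_def)
    then show ?case by (simp only: Udot_relations)
  qed (use assms in \<open>auto simp: left_op_def\<close>)
qed

lemma weight_support:
  "D_E l * D_one l = D_E l"
  "D_F l * D_one l = D_F l"
  "(k *\<^sub>D D_one l) * D_one l = k *\<^sub>D D_one l"
  by (simp_all add: Udot_relations scale_D_mult_left D_one_one)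

lemma left_op_act_expr: "left_op (act_expr u)"
proof (induction u)
  case (Gen g)
  show ?case
    by (cases g) (simp_all add: left_op_lact weight_support, simp add: left_op_def)
next
  case Zero
  show ?case by (simp add: left_op_def)
next
  case (Plus u v)
  then show ?case
    by (simp add: left_op_def Udot.scale_right_distrib distrib_right add_ac)
next
  case (Times u v)
  then show ?case by (simp add: left_op_def)
next
  case (Scale k u)
  then show ?case
    by (simp add: left_op_def Udot.scale_right_distrib scale_D_mult_left mult.commute)
qed

lemma lact_weight_vector:
  assumes f: "\<And>l. f l * D_one l = f l" and x: "D_one m * x = x"
  shows "lact f x = f m * x"
proof -
  have "lact f x = lact f (D_one m * x)" using x by simp
  also have "\<dots> = lact f (D_one m) * x" using left_op_lact[of f] f by (simp add: left_op_def)
  finally show ?thesis using lact_D_one[of f] f by simp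
qed

lemma lact_D_gen:
  assumes "\<And>l. f l * D_one l = f l"
  shows "lact f (D_one l) = f l" "lact f (D_E l) = f (l + 2) * D_E l" "lact f (D_F l) = f (l - 2) * D_F l"
  using assms lact_D_one[of f] lact_weight_vector[of f] Udot_relations by blast+

lemmas lact_simps =
  lact_D_gen[of D_E, OF weight_support(1)]
  lact_D_gen[of D_F, OF weight_support(2)]
  lact_D_gen[of "\<lambda>l. k l *\<^sub>D D_one l" for k, OF weight_support(3)]

lemma lact_scale:
  assumes "\<And>l. f l * D_one l = f l"
  shows "lact f (k *\<^sub>D x) = k *\<^sub>D lact f x"
  using left_op_lact[of f] assms by (simp add: left_op_def)

lemmas lact_scale_simps =
  lact_scale[of D_E, OF weight_support(1)]
  lact_scale[of D_F, OF weight_support(2)]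
  lact_scale[of "\<lambda>l. k l *\<^sub>D D_one l" for k, OF weight_support(3)]

lemma act_expr_cong: "alg_cong uq_rel u v \<Longrightarrow> act_expr u = act_expr v"
proof (induction rule: alg_cong.induct)
  case (rel u v)
  then show ?case
  proof (induction rule: uq_rel.induct)
    case K_Kinv
    show ?case
      by (rule left_op_eqI[OF left_op_act_expr left_op_act_expr])
         (simp add: lact_simps lact_scale_simps power_int_minus)
  next
    case Kinv_K
    show ?case
      by (rule left_op_eqI[OF left_op_act_expr left_op_act_expr])
         (simp add: lact_simps lact_scale_simps power_int_minus)
  next
    case E_F
    have EF: "D_E (l - 2) * D_F l = D_F (l + 2) * D_E l + qint l *\<^sub>D D_one l" for l
      using Udot_relations(5)[of l] by (simp add: algebra_simps)
    show ?case
      by (rule left_op_eqI[OF left_op_act_expr left_op_act_expr])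
         (simp add: lact_simps Udot_relations EF qint_def Udot.scale_left_diff_distrib[symmetric])
  next
    case K_E
    show ?case
      by (rule left_op_eqI[OF left_op_act_expr left_op_act_expr])
         (simp add: lact_simps lact_scale_simps Udot_relations scale_D_mult_left power_int_add mult.commute)
  next
    case K_F
    show ?case
      by (rule left_op_eqI[OF left_op_act_expr left_op_act_expr])
         (simp add: lact_simps lact_scale_simps Udot_relations scale_D_mult_left power_int_diff
            power_int_minus field_simps)
  qed simp_all
next
  case (times_add_right u v w)
  then show ?case using left_op_act_expr[of u] by (simp add: left_op_def)
next
  case (scale_times_right u k v)
  then show ?case using left_op_act_expr[of u] by (simp add: left_op_def)
qed (simp_all add: add_ac Udot.scale_left_distrib Udot.scale_right_distrib)

lift_definition act :: "Uq \<Rightarrow> Udot \<Rightarrow> Udot" (infixr \<open>\<cdot>\<close> 72) is act_expr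
  by (rule act_expr_cong)

lemma act_generators:
  "U_E \<cdot> D_one l = D_E l"
  "U_F \<cdot> D_one l = D_F l"
  "U_K \<cdot> D_one l = (qv powi l) *\<^sub>D D_one l"
  "U_Kinv \<cdot> D_one l = (qv powi (- l)) *\<^sub>D D_one l"
proof -
  show "U_E \<cdot> D_one l = D_E l" by transfer (simp add: lact_simps)
  show "U_F \<cdot> D_one l = D_F l" by transfer (simp add: lact_simps)
  show "U_K \<cdot> D_one l = (qv powi l) *\<^sub>D D_one l" by transfer (simp add: lact_simps)
  show "U_Kinv \<cdot> D_one l = (qv powi (- l)) *\<^sub>D D_one l" by transfer (simp add: lact_simps)
qed

lemma act_module:
  "1 \<cdot> x = x"
  "(u * v) \<cdot> x = u \<cdot> (v \<cdot> x)"
  "(u + v) \<cdot> x = u \<cdot> x + v \<cdot> x"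
  "(k *\<^sub>U u) \<cdot> x = k *\<^sub>D (u \<cdot> x)"
proof -
  show "1 \<cdot> x = x" by transfer simp
  show "(u * v) \<cdot> x = u \<cdot> (v \<cdot> x)" by transfer simp
  show "(u + v) \<cdot> x = u \<cdot> x + v \<cdot> x" by transfer simp
  show "(k *\<^sub>U u) \<cdot> x = k *\<^sub>D (u \<cdot> x)" by transfer simp
qed

lemma left_op_act: "left_op (act u)"
  by transfer (rule left_op_act_expr)

lemma act_left_op:
  "u \<cdot> (x + y) = u \<cdot> x + u \<cdot> y"
  "u \<cdot> (k *\<^sub>D x) = k *\<^sub>D (u \<cdot> x)"
  "u \<cdot> (x * y) = (u \<cdot> x) * y"
  using left_op_act[of u] by (simp_all add: left_op_def)


section \<open>The integral form\<close>

inductive_set A_Udot :: "Udot set"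
  where
    Ediv: "U_Ediv n \<cdot> D_one l \<in> A_Udot"
  | Fdiv: "U_Fdiv n \<cdot> D_one l \<in> A_Udot"
  | one: "D_one l \<in> A_Udot"
  | add: "x \<in> A_Udot \<Longrightarrow> y \<in> A_Udot \<Longrightarrow> x + y \<in> A_Udot"
  | mult: "x \<in> A_Udot \<Longrightarrow> y \<in> A_Udot \<Longrightarrow> x * y \<in> A_Udot"
  | scale: "k \<in> laurent_ring \<Longrightarrow> x \<in> A_Udot \<Longrightarrow> k *\<^sub>D x \<in> A_Udot"

text \<open>
  The sum of the submodules \<open>A_Udot 1\<^sub>2\<^sub>l\<close> is automatically direct, because the \<open>1\<^sub>2\<^sub>l\<close> are
  orthogonal idempotents.
\<close>

definition A_Udot_ev :: "Udot set"
  where "A_Udot_ev = {(\<Sum>l\<in>L. x l * D_one (2 * l)) | (L :: int set) x. finite L \<and> (\<forall>l\<in>L. x l \<in> A_Udot)}"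

end

theory Submission
  imports Defs
begin

text \<open>
  The \<open>\<iota>\<close>-divided powers are determined by \<open>t\<^sub>0 = 1\<close> and the three-term recursion
  \<open>t t\<^sub>n = [n + 1] t\<^sub>n\<^sub>+\<^sub>1 + \<epsilon>\<^sub>n [n] t\<^sub>n\<^sub>-\<^sub>1\<close>, where \<open>\<epsilon>\<^sub>n\<close> is 1 for even \<open>n\<close>
  and 0 for odd \<open>n\<close> (\<open>t_ev_rec\<close>): passing from \<open>t\<^sub>2\<^sub>a\<^sub>-\<^sub>1\<close> to \<open>t\<^sub>2\<^sub>a\<^sub>+\<^sub>1\<close> multiplies
  the product by the two new factors, which give \<open>t\<^sup>2 - [2a]\<^sup>2\<close>. Hence it suffices that the
  claimed right-hand side, called \<open>expansion l n\<close> for both parities of \<open>n\<close>, satisfies the same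
  recursion (\<open>t_expansion\<close>).

  On \<open>E\<^bsup>(a)\<^esup>F\<^bsup>(b)\<^esup>1\<close> the element \<open>t\<close> acts by three terms: it raises \<open>a\<close>, raises \<open>b\<close>,
  or lowers \<open>a\<close>, the last one coming from the commutator of \<open>F\<close> with \<open>E\<^bsup>(a)\<^esup>\<close>
  (\<open>t_pbw\<close>). Comparing the coefficients of each \<open>E\<^bsup>(a)\<^esup>F\<^bsup>(b)\<^esup>1\<close> leaves a scalar identity
  (\<open>coef_rec\<close>). All coefficients that occur in it share a power of \<open>q\<close> and a quantum binomial
  as common factors; after division by these, what remains is an identity between products of at
  most two quantum integers: for odd \<open>n\<close> it is the Ptolemy-type identity \<open>qint_ptolemy\<close>
  combined with the addition rule \<open>qint_add\<close>, for even \<open>n\<close> it is \<open>qint_identity_odd\<close>.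

  Integrality is then visible from the expansion: its coefficients are powers of \<open>q\<close> times
  quantum binomials, which are Laurent polynomials with integer coefficients by the Pascal rule.
\<close>

section \<open>Quantum integers\<close>

lemma qv_power: "qv ^ k = Fract (monom 1 k) 1"
  by (induction k) (simp_all add: qv_def One_fract_def monom_Suc monom_0 one_pCons)

lemma qv_power_neq_1: "k > 0 \<Longrightarrow> qv ^ k \<noteq> 1"
  by (auto simp: qv_power One_fract_def eq_fract monom_eq_1_iff)

lemma qv_powi_neq_minus:
  assumes "n > 0" shows "qv powi n - qv powi (- n) \<noteq> 0"
proof
  assume "qv powi n - qv powi (- n) = 0"
  then have "qv powi n * qv powi n = 1" by (simp add: power_int_minus field_simps)
  then have "qv powi (2 * n) = 1" by (simp flip: power_int_add)
  then have "qv ^ nat (2 * n) = 1" using assms by (simp add: power_int_def split: if_splits)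
  with assms show False using qv_power_neq_1[of "nat (2 * n)"] by simp
qed

lemma qv_minus_inverse_neq_0: "qv - inverse qv \<noteq> 0"
  using qv_powi_neq_minus[of 1] by (simp add: power_int_minus)

lemma qint_neq_0: "n > 0 \<Longrightarrow> qint n \<noteq> 0"
  using qv_powi_neq_minus[of n] qv_minus_inverse_neq_0 by (simp add: qint_def)

lemma qint_0 [simp]: "qint 0 = 0"
  by (simp add: qint_def)

lemma qint_minus: "qint (- n) = - qint n"
  by (simp add: qint_def diff_divide_distrib)

lemma qint_1 [simp]: "qint 1 = 1"
  using qv_minus_inverse_neq_0 by (simp add: qint_def power_int_minus)

lemma qfact_Suc: "qfact (Suc n) = qint (int n + 1) * qfact n"
  by (simp add: qfact_def mult.commute add.commute)

lemma qfact_neq_0: "qfact n \<noteq> 0"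
  by (auto simp: qfact_def qint_neq_0)

lemma qfact_0 [simp]: "qfact 0 = 1"
  by (simp add: qfact_def)

lemma powi_minus_powi_minus: "qv powi n - qv powi (- n) = (qv - inverse qv) * qint n"
  using qv_minus_inverse_neq_0 by (simp add: qint_def)

lemma qint_eqI:
  assumes "(qv - inverse qv) * x = (qv - inverse qv) * y" shows "x = y"
  using assms qv_minus_inverse_neq_0 by simp

text \<open>
  The factors \<open>qv - inverse qv\<close> clear the denominators, so that identities between products of
  two quantum integers become identities between sums of powers of \<open>q\<close>.
\<close>

lemma qint_mult_expand:
  "(qv - inverse qv) * ((qv - inverse qv) * (qint u * qint v)) =
     qv powi (u + v) + qv powi (- u - v) - qv powi (u - v) - qv powi (v - u)"
proof -
  have "(qv - inverse qv) * ((qv - inverse qv) * (qint u * qint v)) =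
      (qv powi u - qv powi (- u)) * (qv powi v - qv powi (- v))"
    unfolding powi_minus_powi_minus by (simp add: mult_ac)
  also have "\<dots> = qv powi (u + v) + qv powi (- u - v) - qv powi (u - v) - qv powi (v - u)"
    by (simp add: algebra_simps flip: power_int_add)
  finally show ?thesis .
qed

lemma qint_add: "qint (a + b) = qv powi b * qint a + qv powi (- a) * qint b"
proof (rule qint_eqI)
  show "(qv - inverse qv) * qint (a + b) = (qv - inverse qv) * (qv powi b * qint a + qv powi (- a) * qint b)"
    unfolding distrib_left mult.left_commute[of "qv - inverse qv" "qv powi _"] powi_minus_powi_minus[symmetric]
    by (simp add: algebra_simps flip: power_int_add)
qed

text \<open>
  Of the powers of \<open>q\<close> in the two products on the left, those with exponents
  \<open>\<plusminus>(u + w - 2v)\<close> cancel and the others are the ones on the right.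
\<close>

lemma qint_ptolemy: "qint (u - v) * qint (w - v) + qint (u + w - v) * qint v = qint u * qint w"
  by (rule qint_eqI, rule qint_eqI, simp only: distrib_left qint_mult_expand)
     (simp add: algebra_simps)

text \<open>
  The quantum binomial in \<open>q\<^sup>2\<close> is a quotient of ordinary quantum integers at even arguments, so
  all identities can be stated with \<open>qint\<close> alone.
\<close>

lemma qbinom2_alt: "qbinom2 m b = (\<Prod>i = 1..b. qint (2 * (m - int i + 1)) / qint (2 * int i))"
  unfolding qbinom2_def mult_minus_left powi_minus_powi_minus
  using qv_minus_inverse_neq_0 by simp

lemma qbinom2_0 [simp]: "qbinom2 m 0 = 1"
  by (simp add: qbinom2_alt)

lemma qbinom2_Suc_bottom: "qbinom2 m (Suc b) = qint (2 * (m - int b)) / qint (2 * (int b + 1)) * qbinom2 m b"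
  by (simp add: qbinom2_alt algebra_simps)

lemma qbinom2_Suc_top: "qbinom2 (m + 1) (Suc b) = qint (2 * (m + 1)) / qint (2 * (int b + 1)) * qbinom2 m b"
proof (induction b)
  case (Suc b)
  have "qbinom2 (m + 1) (Suc (Suc b)) =
     qint (2 * (m - int b)) / qint (2 * (int b + 2)) * qbinom2 (m + 1) (Suc b)"
    by (subst qbinom2_Suc_bottom) (simp add: algebra_simps)
  then show ?case unfolding Suc by (simp add: qbinom2_Suc_bottom algebra_simps)
qed (simp add: qbinom2_Suc_bottom)

text \<open>
  After division by the common factor \<open>qbinom2 m b\<close> this is the addition rule for quantum integers,
  with \<open>2(m + 1)\<close> split as \<open>2(m - b) + 2(b + 1)\<close>.
\<close>

lemma qbinom2_pascal:
  "qbinom2 (m + 1) (Suc b) = qv powi (2 * (int b + 1)) * qbinom2 m (Suc b) + qv powi (2 * (int b - m)) * qbinom2 m b"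
proof -
  have nz: "qint (2 * (int b + 1)) \<noteq> 0" by (simp add: qint_neq_0)
  have "qint (2 * (m + 1)) = qv powi (2 * (int b + 1)) * qint (2 * (m - int b))
      + qv powi (2 * (int b - m)) * qint (2 * (int b + 1))"
    using qint_add[of "2 * (m - int b)" "2 * (int b + 1)"] by (simp add: algebra_simps)
  then show ?thesis using nz
    by (simp add: qbinom2_Suc_top qbinom2_Suc_bottom[of m] add_divide_distrib distrib_right)
qed

section \<open>Laurent polynomials and integrality of quantum binomials\<close>

lemma laurent_ring_monomial: "of_int k * qv powi i \<in> laurent_ring"
  unfolding laurent_ring_def by (rule CollectI, rule exI[of _ "{i}"], rule exI[of _ "\<lambda>_. k"]) simp

lemma laurent_ring_add:
  assumes "x \<in> laurent_ring" "y \<in> laurent_ring" shows "x + y \<in> laurent_ring"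
proof -
  obtain I c where x: "x = (\<Sum>i\<in>I. of_int (c i) * qv powi i)" "finite (I :: int set)"
    using assms(1) by (auto simp: laurent_ring_def)
  obtain J d where y: "y = (\<Sum>i\<in>J. of_int (d i) * qv powi i)" "finite (J :: int set)"
    using assms(2) by (auto simp: laurent_ring_def)
  define c' where "c' i = (if i \<in> I then c i else 0)" for i
  define d' where "d' i = (if i \<in> J then d i else 0)" for i
  have "x = (\<Sum>i\<in>I \<union> J. of_int (c' i) * qv powi i)" unfolding x(1) c'_def
    by (rule sum.mono_neutral_cong_left) (use x y in auto)
  moreover have "y = (\<Sum>i\<in>I \<union> J. of_int (d' i) * qv powi i)" unfolding y(1) d'_def
    by (rule sum.mono_neutral_cong_left) (use x y in auto)
  ultimately have "x + y = (\<Sum>i\<in>I \<union> J. of_int (c' i + d' i) * qv powi i)"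
    by (simp add: sum.distrib distrib_right)
  then show ?thesis unfolding laurent_ring_def using x(2) y(2)
    by (intro CollectI exI[of _ "I \<union> J"] exI[of _ "\<lambda>i. c' i + d' i"]) simp
qed

lemma laurent_ring_0: "0 \<in> laurent_ring"
  using laurent_ring_monomial[of 0] by simp

lemma laurent_ring_sum: "(\<And>i. i \<in> I \<Longrightarrow> f i \<in> laurent_ring) \<Longrightarrow> sum f I \<in> laurent_ring"
  by (induction I rule: infinite_finite_induct) (auto intro: laurent_ring_add laurent_ring_0)

lemma laurent_ring_mult:
  assumes "x \<in> laurent_ring" "y \<in> laurent_ring" shows "x * y \<in> laurent_ring"
proof -
  obtain I c where x: "x = (\<Sum>i\<in>I. of_int (c i) * qv powi i)"
    using assms(1) by (auto simp: laurent_ring_def)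
  obtain J d where y: "y = (\<Sum>j\<in>J. of_int (d j) * qv powi j)"
    using assms(2) by (auto simp: laurent_ring_def)
  have "of_int k * qv powi i * (of_int l * qv powi j) \<in> laurent_ring" for k l i j
    using laurent_ring_monomial[of "k * l" "i + j"] by (simp add: power_int_add mult_ac)
  then show ?thesis unfolding x y sum_product by (intro laurent_ring_sum)
qed

lemma laurent_ring_powi: "qv powi i \<in> laurent_ring"
  using laurent_ring_monomial[of 1 i] by simp

lemma laurent_ring_diff:
  assumes "x \<in> laurent_ring" "y \<in> laurent_ring" shows "x - y \<in> laurent_ring"
  using laurent_ring_add[OF assms(1) laurent_ring_mult[OF laurent_ring_monomial[of "- 1" 0] assms(2)]]
  by simp

text \<open>
  For a fixed positive bottom entry, the values at \<open>m\<close> and \<open>m + 1\<close> enter the Pascal rule with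
  unit coefficients, next to a binomial with smaller bottom entry. So the rule carries
  integrality from \<open>m = 0\<close>, where the binomial vanishes, both upwards and downwards.
\<close>

lemma qbinom2_laurent: "qbinom2 m b \<in> laurent_ring"
proof (induction b arbitrary: m)
  case 0
  then show ?case using laurent_ring_powi[of 0] by simp
next
  case (Suc b)
  show ?case
  proof (induction m rule: int_induct[of _ 0])
    case base
    have "qbinom2 0 (Suc b) = 0"
      using qbinom2_Suc_top[of "- 1" b] by simp
    then show ?case by (simp add: laurent_ring_0)
  next
    case (step1 m)
    then show ?case unfolding qbinom2_pascal
      by (intro laurent_ring_add laurent_ring_mult laurent_ring_powi Suc)
  next
    case (step2 m)
    have "qbinom2 (m - 1) (Suc b) = qv powi (- (2 * (int b + 1))) *
        (qbinom2 m (Suc b) - qv powi (2 * (int b - (m - 1))) * qbinom2 (m - 1) b)"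
      using qbinom2_pascal[of "m - 1" b] by (simp only: diff_add_cancel add_diff_cancel_right' power_int_minus) simp
    then show ?case
      using step2 by (auto intro!: laurent_ring_diff laurent_ring_mult laurent_ring_powi Suc)
  qed
qed

section \<open>Generators acting on weight vectors\<close>

lemma act_sum: "u \<cdot> (\<Sum>i\<in>I. f i) = (\<Sum>i\<in>I. u \<cdot> f i)"
proof -
  have "u \<cdot> 0 = 0" using left_op_act[of u] by (simp add: left_op_def)
  then show ?thesis
    by (induction I rule: infinite_finite_induct) (simp_all add: act_left_op)
qed

lemma act_diff_left: "(u - v) \<cdot> x = u \<cdot> x - v \<cdot> x"
  using act_module(3)[of "u - v" v x] by (simp add: algebra_simps)

lemma act_diff_right: "u \<cdot> (x - y) = u \<cdot> x - u \<cdot> y"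
  using act_left_op(1)[of u "x - y" y] by (simp add: algebra_simps)

text \<open>
  On a vector of weight \<open>l\<close> also \<open>EF - FE\<close> acts as a scalar, namely \<open>[l]\<close>. So on weight vectors
  only \<open>E\<close> and \<open>F\<close> have to be tracked.
\<close>

definition weight :: "int \<Rightarrow> Udot \<Rightarrow> bool"
  where "weight l x \<longleftrightarrow> U_K \<cdot> x = (qv powi l) *\<^sub>D x"

lemma weight_one: "weight l (D_one l)"
  by (simp add: weight_def act_generators)

lemma weight_Kinv:
  assumes "weight l x" shows "U_Kinv \<cdot> x = (qv powi (- l)) *\<^sub>D x"
proof -
  have "x = U_Kinv \<cdot> U_K \<cdot> x" by (simp add: Uq_relations act_module flip: act_module(2))
  also have "\<dots> = (qv powi l) *\<^sub>D (U_Kinv \<cdot> x)" using assms by (simp add: weight_def act_left_op)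
  finally have "(qv powi (- l)) *\<^sub>D x = (qv powi (- l)) *\<^sub>D (qv powi l) *\<^sub>D (U_Kinv \<cdot> x)" by simp
  then show ?thesis by (simp add: power_int_minus)
qed

lemma weight_scale: "weight l x \<Longrightarrow> weight l (k *\<^sub>D x)"
  by (simp add: weight_def act_left_op mult.commute)

lemma weight_E: assumes "weight l x" shows "weight (l + 2) (U_E \<cdot> x)"
proof -
  have "U_K \<cdot> U_E \<cdot> x = (qv powi 2) *\<^sub>D (U_E \<cdot> U_K \<cdot> x)"
    by (simp add: Uq_relations act_module flip: act_module(2))
  then show ?thesis using assms by (simp add: weight_def act_left_op power_int_add mult.commute)
qed

lemma weight_F: assumes "weight l x" shows "weight (l - 2) (U_F \<cdot> x)"
proof -
  have "U_K \<cdot> U_F \<cdot> x = (qv powi (- 2)) *\<^sub>D (U_F \<cdot> U_K \<cdot> x)"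
    by (simp add: Uq_relations act_module flip: act_module(2))
  then show ?thesis using assms
    by (simp add: weight_def act_left_op) (simp flip: power_int_add)
qed

lemma weight_E_power: "weight l x \<Longrightarrow> weight (l + 2 * int n) (U_E ^ n \<cdot> x)"
proof (induction n)
  case (Suc n)
  then show ?case using weight_E[of "l + 2 * int n" "U_E ^ n \<cdot> x"]
    by (simp add: act_module algebra_simps)
qed (simp add: act_module)

lemma weight_F_power: "weight l x \<Longrightarrow> weight (l - 2 * int n) (U_F ^ n \<cdot> x)"
proof (induction n)
  case (Suc n)
  then show ?case using weight_F[of "l - 2 * int n" "U_F ^ n \<cdot> x"]
    by (simp add: act_module algebra_simps)
qed (simp add: act_module)

lemma FE_weight:
  assumes "weight l x" shows "U_F \<cdot> U_E \<cdot> x = U_E \<cdot> U_F \<cdot> x - qint l *\<^sub>D x"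
proof -
  have "U_E \<cdot> U_F \<cdot> x - U_F \<cdot> U_E \<cdot> x = (U_E * U_F - U_F * U_E) \<cdot> x"
    by (simp add: act_diff_left act_module)
  also have "\<dots> = (1 / (qv - inverse qv)) *\<^sub>D (U_K \<cdot> x - U_Kinv \<cdot> x)"
    by (simp only: Uq_relations act_module act_diff_left)
  also have "\<dots> = qint l *\<^sub>D x"
    using assms weight_Kinv[OF assms]
    by (simp add: weight_def qint_def Udot.scale_left_diff_distrib[symmetric])
  finally show ?thesis by (simp add: algebra_simps)
qed

text \<open>
  Moving \<open>F\<close> past each factor \<open>E\<close> costs \<open>[weight]\<close>; the costs along the string
  \<open>l, l + 2, \<dots>, l + 2n\<close> add up to \<open>[n + 1][l + n]\<close> by the Ptolemy-type identity.
\<close>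

lemma F_E_power:
  assumes "weight l x"
  shows "U_F \<cdot> (U_E ^ Suc n \<cdot> x) =
    U_E ^ Suc n \<cdot> (U_F \<cdot> x) - (qint (int n + 1) * qint (l + int n)) *\<^sub>D (U_E ^ n \<cdot> x)"
proof (induction n)
  case 0
  then show ?case using FE_weight[OF assms] by (simp add: act_module)
next
  case (Suc n)
  have q: "qint (int n + 1) * qint (l + int n) + qint (l + 2 * (int n + 1)) =
      qint (int n + 2) * qint (l + int n + 1)"
    using qint_ptolemy[of "int n + 2" 1 "l + int n + 1"] by (simp add: algebra_simps)
  have w: "weight (l + 2 * (int n + 1)) (U_E ^ Suc n \<cdot> x)"
    using weight_E_power[OF assms, of "Suc n"] by (simp add: algebra_simps)
  have "U_F \<cdot> (U_E ^ Suc (Suc n) \<cdot> x) = U_F \<cdot> U_E \<cdot> (U_E ^ Suc n \<cdot> x)"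
    by (simp add: act_module)
  also have "\<dots> = U_E \<cdot> U_F \<cdot> (U_E ^ Suc n \<cdot> x) - qint (l + 2 * (int n + 1)) *\<^sub>D (U_E ^ Suc n \<cdot> x)"
    by (rule FE_weight[OF w])
  also have "\<dots> = U_E ^ Suc (Suc n) \<cdot> (U_F \<cdot> x) -
      (qint (int n + 1) * qint (l + int n) + qint (l + 2 * (int n + 1))) *\<^sub>D (U_E ^ Suc n \<cdot> x)"
    unfolding Suc
    by (simp add: act_diff_right act_left_op Udot.scale_left_distrib act_module algebra_simps)
  finally show ?case unfolding q by (simp add: algebra_simps)
qed

text \<open>
  The vectors \<open>E\<^bsup>(a)\<^esup>F\<^bsup>(b)\<^esup>1\<^sub>l\<close> of Poincare-Birkhoff-Witt type.
\<close>

definition pbw :: "int \<Rightarrow> nat \<Rightarrow> nat \<Rightarrow> Udot"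
  where "pbw l a b = (U_Ediv a * U_Fdiv b) \<cdot> D_one l"

lemma pbw_powers:
  "pbw l a b = (1 / (qfact a * qfact b)) *\<^sub>D (U_E ^ a \<cdot> (U_F ^ b \<cdot> D_one l))"
  by (simp add: pbw_def U_Ediv_def U_Fdiv_def act_module act_left_op)

lemma weight_pbw: "weight (l + 2 * int a - 2 * int b) (pbw l a b)"
  using weight_E_power[OF weight_F_power[OF weight_one], of l b a]
  unfolding pbw_powers by (intro weight_scale) (simp add: algebra_simps)

lemma E_pbw: "U_E \<cdot> pbw l a b = qint (int a + 1) *\<^sub>D pbw l (Suc a) b"
  using qint_neq_0[of "int a + 1"]
  by (simp add: pbw_powers act_left_op act_module qfact_Suc)

lemma Echeck_pbw:
  "U_Echeck \<cdot> pbw l a b =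
     (qv powi (2 * int b - 2 * int a - l - 1) * qint (int a + 1)) *\<^sub>D pbw l (Suc a) b"
proof -
  have "inverse qv * qv powi (- (l + 2 * int a - 2 * int b)) = qv powi (2 * int b - 2 * int a - l - 1)"
    by (subst power_int_diff) (simp_all add: field_simps)
  then show ?thesis
    by (simp add: U_Echeck_def act_module weight_Kinv[OF weight_pbw] act_left_op E_pbw flip: mult.assoc)
qed

lemma F_pbw:
  "U_F \<cdot> pbw l a b = qint (int b + 1) *\<^sub>D pbw l a (Suc b)
     - (if a = 0 then 0 else qint (l - 2 * int b + int a - 1) *\<^sub>D pbw l (a - 1) b)"
proof (cases a)
  case 0
  then show ?thesis using qint_neq_0[of "int b + 1"]
    by (simp add: pbw_powers act_left_op act_module qfact_Suc)
next
  case (Suc a')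
  show ?thesis
    using qint_neq_0[of "int b + 1"] qint_neq_0[of "int a' + 1"]
    unfolding Suc pbw_powers act_left_op F_E_power[OF weight_F_power[OF weight_one]] 
    by (simp add: qfact_Suc act_module Udot.scale_right_diff_distrib algebra_simps)
qed

section \<open>The recursion of the \<open>\<iota>\<close>-divided powers\<close>

text \<open>
  The \<open>\<iota>\<close>-divided power of order \<open>2a + 1\<close> without its denominator. The even one of order
  \<open>2a + 2\<close> is \<open>t\<close> times the same product, which is why the recursion depends on the parity.
\<close>

definition odd_prod :: "nat \<Rightarrow> Uq"
  where "odd_prod a = prod_list (map (\<lambda>i. U_t - qint (2 * i) *\<^sub>U 1) [- int a..int a])"

lemma t_commute_factor: "U_t * (U_t - k *\<^sub>U 1) = (U_t - k *\<^sub>U 1) * U_t"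
  by (simp add: algebra_simps scale_U_mult_left scale_U_mult_right)

lemma t_commute_prod:
  "U_t * prod_list (map (\<lambda>i. U_t - f i *\<^sub>U 1) xs) = prod_list (map (\<lambda>i. U_t - f i *\<^sub>U 1) xs) * U_t"
proof (induction xs)
  case (Cons x xs)
  let ?p = "prod_list (map (\<lambda>i. U_t - f i *\<^sub>U 1) xs)"
  have "U_t * ((U_t - f x *\<^sub>U 1) * ?p) = (U_t - f x *\<^sub>U 1) * (U_t * ?p)"
    by (simp only: t_commute_factor flip: mult.assoc)
  then show ?case by (simp add: Cons mult.assoc)
qed simp

lemma odd_prod_0: "odd_prod 0 = U_t"
  by (simp add: odd_prod_def)

text \<open>
  The two new factors are \<open>t + [2(a + 1)]\<close> and \<open>t - [2(a + 1)]\<close>; they sit at the two ends of the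
  product and are brought together because everything commutes with \<open>t\<close>.
\<close>

lemma odd_prod_Suc:
  "odd_prod (Suc a) = U_t * (U_t * odd_prod a) - (qint (2 * (int a + 1)))\<^sup>2 *\<^sub>U odd_prod a"
proof -
  define k where "k = qint (2 * (int a + 1))"
  have split: "[- int (Suc a)..int (Suc a)] = (- int (Suc a)) # [- int a..int a] @ [int (Suc a)]"
    by (subst upto_rec1, simp, subst upto_rec2) simp_all
  have k': "qint (2 * (- int (Suc a))) = - k" "qint (2 * int (Suc a)) = k"
    using qint_minus[of "2 * int (Suc a)"] by (simp_all add: k_def algebra_simps)
  have comm: "odd_prod a * U_t = U_t * odd_prod a"
    unfolding odd_prod_def by (rule t_commute_prod[symmetric])
  have "odd_prod (Suc a) = (U_t - (- k) *\<^sub>U 1) * (odd_prod a * (U_t - k *\<^sub>U 1))"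
    unfolding odd_prod_def split by (simp only: list.map map_append prod_list.Cons prod_list.append k') simp
  also have "odd_prod a * (U_t - k *\<^sub>U 1) = U_t * odd_prod a - k *\<^sub>U odd_prod a"
    by (simp add: right_diff_distrib scale_U_mult_right comm)
  also have "(U_t - (- k) *\<^sub>U 1) * (U_t * odd_prod a - k *\<^sub>U odd_prod a) =
     U_t * (U_t * odd_prod a) - k\<^sup>2 *\<^sub>U odd_prod a"
    by (simp add: algebra_simps scale_U_mult_left scale_U_mult_right power2_eq_square)
  finally show ?thesis by (simp add: k_def)
qed

lemma t_ev_odd: "t_ev (2 * a + 1) = (1 / qfact (2 * a + 1)) *\<^sub>U odd_prod a"
  by (simp add: t_ev_def odd_prod_def Let_def)

lemma t_ev_even: "t_ev (2 * a + 2) = (1 / qfact (2 * a + 2)) *\<^sub>U (U_t * odd_prod a)"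
  by (simp add: t_ev_def odd_prod_def Let_def)

lemma t_ev_step_odd:
  "U_t * t_ev (2 * a + 1) = qint (2 * int a + 2) *\<^sub>U t_ev (2 * a + 2)"
  unfolding t_ev_odd t_ev_even scale_U_mult_right
  using qint_neq_0[of "2 * int a + 2"] by (simp add: qfact_Suc add.commute)

lemma t_ev_step_even:
  "U_t * t_ev (2 * a + 2) =
     qint (2 * int a + 3) *\<^sub>U t_ev (2 * a + 3) + qint (2 * int a + 2) *\<^sub>U t_ev (2 * a + 1)"
proof -
  have q: "qfact (2 * a + 2) = qint (2 * int a + 2) * qfact (2 * a + 1)"
     "qfact (2 * a + 3) = qint (2 * int a + 3) * qfact (2 * a + 2)"
    using qfact_Suc[of "2 * a + 1"] qfact_Suc[of "2 * a + 2"] by (simp_all add: add.commute numeral_3_eq_3)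
  have "U_t * (U_t * odd_prod a) = odd_prod (Suc a) + (qint (2 * int a + 2))\<^sup>2 *\<^sub>U odd_prod a"
    by (simp add: odd_prod_Suc distrib_left)
  moreover have "t_ev (2 * a + 3) = (1 / qfact (2 * a + 3)) *\<^sub>U odd_prod (Suc a)"
    using t_ev_odd[of "Suc a"] by (simp add: eval_nat_numeral)
  ultimately show ?thesis
    unfolding t_ev_odd t_ev_even scale_U_mult_right
    using qint_neq_0[of "2 * int a + 2"] qint_neq_0[of "2 * int a + 3"]
    by (simp add: Uq.scale_right_distrib q power2_eq_square qfact_neq_0 del: add_2_eq_Suc' One_nat_def)
qed

lemma t_ev_0 [simp]: "t_ev 0 = 1"
  by (simp add: t_ev_def)

lemma t_ev_1: "t_ev 1 = U_t"
  using t_ev_odd[of 0] by (simp add: odd_prod_0 qfact_Suc)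

text \<open>
  For \<open>n = 0\<close> the truncated predecessor \<open>n - 1 = 0\<close> does no harm, since its factor is \<open>[0] = 0\<close>.
\<close>

lemma t_ev_rec:
  "qint (int n + 1) *\<^sub>U t_ev (n + 1) =
     U_t * t_ev n - (if even n then qint (int n) *\<^sub>U t_ev (n - 1) else 0)"
proof (cases "even n")
  case True
  show ?thesis
  proof (cases "n = 0")
    case False
    with True obtain a where "n = 2 * a + 2"
      by (metis dvd_def add_2_eq_Suc' mult_Suc_right not0_implies_Suc mult_0_right add.commute)
    then show ?thesis using t_ev_step_even[of a] by (simp add: algebra_simps numeral_3_eq_3)
  qed (simp add: t_ev_1[unfolded One_nat_def])
next
  case False
  then obtain a where "n = 2 * a + 1" by (elim oddE)
  then show ?thesis using t_ev_step_odd[of a] by (simp add: algebra_simps)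
qed

section \<open>The coefficients of the expansion\<close>

text \<open>
  The coefficient of \<open>E\<^bsup>(a)\<^esup>F\<^bsup>(n - 2c - a)\<^esup>1\<^sub>2\<^sub>l\<close> for either parity: \<open>n\<close> is \<open>2m\<close> or \<open>2m - 1\<close>,
  and \<open>s\<close> is 1 in the odd case. The index \<open>a\<close> is an integer because the recursion refers to
  \<open>a - 1\<close> also for \<open>a = 0\<close>.
\<close>

definition coef :: "nat \<Rightarrow> int \<Rightarrow> nat \<Rightarrow> int \<Rightarrow> ratfun"
  where "coef n l c a =
    (let m = int ((n + 1) div 2); s = int (n mod 2)
     in qv powi (2 * (a + int c) * (m - a - l) - 2 * a * int c - s * a - binom2 (2 * int c + 1))
        * qbinom2 (m - int c - a - l - s) c)"

lemma binom2_odd: "binom2 (2 * c + 1) = c * (2 * c + 1)"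
proof -
  have "(2 * c + 1) * (2 * c + 1 - 1) = 2 * (c * (2 * c + 1))" by (simp add: algebra_simps)
  then show ?thesis by (simp add: binom2_def)
qed

text \<open>
  The power of \<open>q\<close> in an even coefficient, with \<open>x = m - a - l\<close>. The exponent is quadratic, but under
  the shifts that occur in the recursion it changes by a linear amount, so that the quadratic part
  is a common factor of the recursion.
\<close>

definition coef_monomial :: "int \<Rightarrow> int \<Rightarrow> int \<Rightarrow> ratfun"
  where "coef_monomial a c x = qv powi (2 * (a + c) * x - 2 * a * c - c * (2 * c + 1))"

lemma coef_monomial_shift:
  "coef_monomial (a - 1) c (x + 1) = qv powi (2 * a + 4 * c - 2 * x - 2) * coef_monomial a c x"
  "coef_monomial (a - 1) c x = qv powi (2 * c - 2 * x) * coef_monomial a c x"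
  "coef_monomial a c (x - 1) = qv powi (- 2 * a - 2 * c) * coef_monomial a c x"
  "coef_monomial (a + 1) (c - 1) (x - 1) = qv powi 1 * coef_monomial a c x"
  "coef_monomial (a + 1) (c - 1) (x - 2) = qv powi (1 - 2 * a - 2 * c) * coef_monomial a c x"
  "coef_monomial a (c - 1) (x - 1) = qv powi (1 + 2 * c - 2 * x) * coef_monomial a c x"
  unfolding coef_monomial_def by (simp_all add: algebra_simps del: power_int_1_right flip: power_int_add)

lemma coef_even:
  assumes "x = int m - a - l"
  shows "coef (2 * m) l c a = coef_monomial a (int c) x * qbinom2 (x - int c) c"
proof -
  have x: "int m - int c - a - l - 0 = x - int c" using assms by simp
  have "(2 * m + 1) div 2 = m" "2 * m mod 2 = 0" by simp_all
  then show ?thesis unfolding coef_def Let_def coef_monomial_def binom2_odd by (simp only: of_nat_0 x assms[symmetric]) simp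
qed

lemma coef_odd:
  assumes "x = int m + 1 - a - l"
  shows "coef (2 * m + 1) l c a = qv powi (- a) * coef_monomial a (int c) x * qbinom2 (x - int c - 1) c"
proof -
  have x: "int (m + 1) - int c - a - l - 1 = x - int c - 1" "int (m + 1) - a - l = x" using assms by simp_all
  have n: "(2 * m + 1 + 1) div 2 = m + 1" "(2 * m + 1) mod 2 = 1" by simp_all
  show ?thesis unfolding coef_def Let_def coef_monomial_def binom2_odd n of_nat_1 x
    by (simp add: algebra_simps flip: power_int_add)
qed

text \<open>
  This is what remains of the coefficient recursion when the new index \<open>n\<close> is even. The bracket is
  \<open>[n - a][2x - 2c]\<close> by the Ptolemy-type identity, and then the addition rule applies to
  \<open>n = a + (n - a)\<close>.
\<close>

lemma qint_identity_even:
  "qint n * qint (2 * x - 2 * c) = qv powi (n - a) * qint a * qint (2 * x - 2 * c)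
     + qv powi (- a) * (qint (n - a - 2 * c) * qint (2 * x - 4 * c) + qint (n - a + 2 * x - 4 * c) * qint (2 * c))"
proof -
  have "qint (n - a - 2 * c) * qint (2 * x - 4 * c) + qint (n - a + 2 * x - 4 * c) * qint (2 * c) =
      qint (n - a) * qint (2 * x - 2 * c)"
    using qint_ptolemy[of "n - a" "2 * c" "2 * x - 2 * c"] by (simp add: algebra_simps)
  moreover have "qint n = qv powi (n - a) * qint a + qv powi (- a) * qint (n - a)"
    using qint_add[of a "n - a"] by simp
  ultimately show ?thesis by (simp add: algebra_simps)
qed

text \<open>
  The counterpart for an odd new index \<open>n + 1\<close>; the last term comes from the subtraction of the
  \<open>\<iota>\<close>-divided power of order \<open>n - 1\<close>. Both sides are compared power by power.
\<close>

lemma qint_identity_odd: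
  "qint (n + 1) * qint (2 * x - 4 * c) = qv powi (n + 1 - a - 2 * c) * qint a * qint (2 * x - 2 * c)
     + qv powi (- a - 2 * c) * qint (n + 1 - a - 2 * c) * qint (2 * x - 4 * c)
     + qv powi (1 - a - 2 * c) * qint (n - a + 2 * x - 4 * c) * qint (2 * c)
     - qv powi (1 + 2 * c - 2 * x) * qint n * qint (2 * c)"
  by (rule qint_eqI, rule qint_eqI,
      simp only: distrib_left right_diff_distrib mult.assoc mult.left_commute[of "qv - inverse qv" "qv powi _"] qint_mult_expand)
     (simp add: algebra_simps flip: power_int_add)

text \<open>
  The three binomials in one instance of the recursion are multiples of the same scalar \<open>P\<close>.
  With \<open>c = d + 1\<close> it is the third one divided by \<open>[2c]\<close>, which is where \<open>c > 0\<close> matters.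
\<close>

lemma qbinom2_common:
  obtains P where "qbinom2 (x - int (Suc d)) (Suc d) = qint (2 * x - 2 * int (Suc d)) * P"
    and "qbinom2 (x - int (Suc d) - 1) (Suc d) = qint (2 * x - 4 * int (Suc d)) * P"
    and "qbinom2 (x - int (Suc d) - 1) d = qint (2 * int (Suc d)) * P"
proof
  define P where "P = qbinom2 (x - int (Suc d) - 1) d / qint (2 * int (Suc d))"
  show "qbinom2 (x - int (Suc d)) (Suc d) = qint (2 * x - 2 * int (Suc d)) * P"
    using qbinom2_Suc_top[of "x - int (Suc d) - 1" d] by (simp add: P_def algebra_simps)
  show "qbinom2 (x - int (Suc d) - 1) (Suc d) = qint (2 * x - 4 * int (Suc d)) * P"
    using qbinom2_Suc_bottom[of "x - int (Suc d) - 1" d] by (simp add: P_def algebra_simps)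
  show "qbinom2 (x - int (Suc d) - 1) d = qint (2 * int (Suc d)) * P"
    using qint_neq_0[of "2 * int (Suc d)"] by (simp add: P_def del: of_nat_Suc)
qed

lemma powi_combine: "qv powi i * (qv powi j * y) = qv powi (i + j) * y"
  by (simp add: power_int_add)

lemma coef_rec_even:
  assumes "b = 2 * int m + 2 - 2 * int c - a"
  shows "qint (2 * int m + 2) * coef (2 * m + 2) l c a =
     qv powi (2 * b - 2 * a + 1 - 2 * l) * qint a * coef (2 * m + 1) l c (a - 1)
     + qint b * coef (2 * m + 1) l c a
     - (if c = 0 then 0 else qint (2 * l - 2 * b + a) * coef (2 * m + 1) l (c - 1) (a + 1))"
proof -
  define x where "x = int m + 1 - a - l"
  define n where "n = 2 * int m + 2"
  define G where "G = coef_monomial a (int c) x"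
  have l: "2 * b - 2 * a + 1 - 2 * l = n - 2 * a - 4 * int c + 2 * x + 1"
    and b: "b = n - a - 2 * int c" and L: "qint (2 * l - 2 * b + a) = - qint (n - a + 2 * x - 4 * int c)"
    unfolding qint_minus[symmetric] assms x_def n_def by (simp_all add: algebra_simps)
  have e0: "coef (2 * m + 2) l c a = G * qbinom2 (x - int c) c"
    using coef_even[of x "m + 1" a l c] by (simp add: x_def G_def)
  have e1: "coef (2 * m + 1) l c (a - 1) = qv powi (a + 4 * int c - 2 * x - 1) * (G * qbinom2 (x - int c) c)"
  proof -
    have "coef (2 * m + 1) l c (a - 1) = qv powi (- (a - 1)) * coef_monomial (a - 1) (int c) (x + 1) * qbinom2 (x + 1 - int c - 1) c"
      by (rule coef_odd) (simp add: x_def)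
    moreover have "x + 1 - int c - 1 = x - int c" "- (a - 1) + (2 * a + 4 * int c - 2 * x - 2) = a + 4 * int c - 2 * x - 1"
      by simp_all
    ultimately show ?thesis by (simp only: coef_monomial_shift(1) mult.assoc powi_combine G_def)
  qed
  have e2: "coef (2 * m + 1) l c a = qv powi (- a) * (G * qbinom2 (x - int c - 1) c)"
    using coef_odd[of x m a l c] by (simp add: x_def G_def)
  have q: "qv powi (n - 2 * a - 4 * int c + 2 * x + 1) * qv powi (a + 4 * int c - 2 * x - 1) = qv powi (n - a)"
    by (simp flip: power_int_add)
  show ?thesis
  proof (cases c)
    case 0
    have B: "qbinom2 (x - int c) c = 1" "qbinom2 (x - int c - 1) c = 1" by (simp_all add: 0)
    have "qint n = qv powi (n - a) * qint a + qv powi (- a) * qint (n - a - 2 * int c)"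
      using qint_add[of a "n - a"] by (simp add: 0)
    then have "qint n * G = (qv powi (n - a) * qint a + qv powi (- a) * qint (n - a - 2 * int c)) * G" by simp
    then show ?thesis unfolding e0 e1 e2 l n_def[symmetric] if_P[OF 0] B q[symmetric] unfolding b
      by (simp only: ring_distribs mult_minus_left mult_minus_right minus_minus diff_minus_eq_add
          diff_0_right mult_1_right mult_ac add_ac)
  next
    case (Suc d)
    have "coef (2 * m + 1) l d (a + 1) = qv powi (- (a + 1)) * coef_monomial (a + 1) (int c - 1) (x - 1) * qbinom2 (x - 1 - int d - 1) d"
      using coef_odd[of "x - 1" m "a + 1" l d] by (simp add: Suc x_def)
    moreover have "x - 1 - int d - 1 = x - int c - 1" "- (a + 1) + 1 = - a"
      by (simp_all add: Suc)
    ultimately have e3: "coef (2 * m + 1) l (c - 1) (a + 1) = qv powi (- a) * (G * qbinom2 (x - int c - 1) d)"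
      by (simp only: coef_monomial_shift(4) mult.assoc powi_combine G_def) (simp add: Suc)
    obtain P where P: "qbinom2 (x - int c) c = qint (2 * x - 2 * int c) * P"
      "qbinom2 (x - int c - 1) c = qint (2 * x - 4 * int c) * P"
      "qbinom2 (x - int c - 1) d = qint (2 * int c) * P"
      using qbinom2_common[of x d] unfolding Suc by blast
    have c: "c \<noteq> 0" using Suc by simp
    show ?thesis using arg_cong[OF qint_identity_even[of n x "int c" a], of "\<lambda>z. z * (G * P)"]
      unfolding e0 e1 e2 e3 P L if_not_P[OF c] l n_def[symmetric] q[symmetric] unfolding b
      by (simp only: ring_distribs mult_minus_left mult_minus_right minus_minus diff_minus_eq_add
          diff_0_right mult_1_right mult_ac add_ac)
  qed
qed

lemma coef_rec_odd:
  assumes "b = 2 * int m + 1 - 2 * int c - a"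
  shows "qint (2 * int m + 1) * coef (2 * m + 1) l c a =
     qv powi (2 * b - 2 * a + 1 - 2 * l) * qint a * coef (2 * m) l c (a - 1)
     + qint b * coef (2 * m) l c a
     - (if c = 0 then 0 else qint (2 * l - 2 * b + a) * coef (2 * m) l (c - 1) (a + 1)
          + qint (2 * int m) * coef (2 * m - 1) l (c - 1) a)"
proof -
  define x where "x = int m + 1 - a - l"
  define n where "n = 2 * int m"
  \<comment> \<open>In an odd coefficient the factor \<open>q\<^bsup>-a\<^esup>\<close> is present as well, so it is made part of \<open>G\<close>.\<close>
  define G where "G = qv powi (- a) * coef_monomial a (int c) x"
  have coef_monomial: "coef_monomial a (int c) x = qv powi a * G"
    by (simp add: G_def power_int_minus)
  have l: "2 * b - 2 * a + 1 - 2 * l = n + 1 - 2 * a - 4 * int c + 2 * x"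
    and b: "b = n + 1 - a - 2 * int c" and L: "qint (2 * l - 2 * b + a) = - qint (n - a + 2 * x - 4 * int c)"
    unfolding qint_minus[symmetric] assms x_def n_def by (simp_all add: algebra_simps)
  have e0: "coef (2 * m + 1) l c a = G * qbinom2 (x - int c - 1) c"
    using coef_odd[of x m a l c] by (simp add: x_def G_def)
  have e1: "coef (2 * m) l c (a - 1) = qv powi (2 * int c - 2 * x + a) * (G * qbinom2 (x - int c) c)"
  proof -
    have "coef (2 * m) l c (a - 1) = coef_monomial (a - 1) (int c) x * qbinom2 (x - int c) c"
      by (rule coef_even) (simp add: x_def)
    then show ?thesis by (simp only: coef_monomial_shift(2) coef_monomial mult.assoc powi_combine)
  qed
  have e2: "coef (2 * m) l c a = qv powi (- a - 2 * int c) * (G * qbinom2 (x - int c - 1) c)"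
  proof -
    have "coef (2 * m) l c a = coef_monomial a (int c) (x - 1) * qbinom2 (x - 1 - int c) c"
      by (rule coef_even) (simp add: x_def)
    moreover have "x - 1 - int c = x - int c - 1" "- 2 * a - 2 * int c + a = - a - 2 * int c" by simp_all
    ultimately show ?thesis by (simp only: coef_monomial_shift(3) coef_monomial mult.assoc powi_combine)
  qed
  have q: "qv powi (n + 1 - 2 * a - 4 * int c + 2 * x) * qv powi (2 * int c - 2 * x + a) = qv powi (n + 1 - a - 2 * int c)"
    by (simp add: algebra_simps flip: power_int_add)
  show ?thesis
  proof (cases c)
    case 0
    have B: "qbinom2 (x - int c) c = 1" "qbinom2 (x - int c - 1) c = 1" by (simp_all add: 0)
    have "qint (n + 1) = qv powi (n + 1 - a - 2 * int c) * qint a + qv powi (- a - 2 * int c) * qint (n + 1 - a - 2 * int c)"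
      using qint_add[of a "n + 1 - a"] by (simp add: 0)
    then have "qint (n + 1) * G = (qv powi (n + 1 - a - 2 * int c) * qint a +
        qv powi (- a - 2 * int c) * qint (n + 1 - a - 2 * int c)) * G" by simp
    then show ?thesis unfolding e0 e1 e2 l n_def[symmetric] if_P[OF 0] B q[symmetric] unfolding b
      by (simp only: ring_distribs mult_minus_left mult_minus_right minus_minus diff_minus_eq_add
          diff_0_right mult_1_right mult_ac add_ac)
  next
    case (Suc d)
    have e3: "coef (2 * m) l (c - 1) (a + 1) = qv powi (1 - a - 2 * int c) * (G * qbinom2 (x - int c - 1) d)"
    proof -
      have "coef (2 * m) l d (a + 1) = coef_monomial (a + 1) (int d) (x - 2) * qbinom2 (x - 2 - int d) d"
        by (rule coef_even) (simp add: x_def)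
      moreover have "x - 2 - int d = x - int c - 1" "int d = int c - 1" "c - 1 = d"
        "1 - 2 * a - 2 * int c + a = 1 - a - 2 * int c" by (simp_all add: Suc)
      ultimately show ?thesis by (simp only: coef_monomial_shift(5) coef_monomial mult.assoc powi_combine)
    qed
    obtain P where P: "qbinom2 (x - int c) c = qint (2 * x - 2 * int c) * P"
      "qbinom2 (x - int c - 1) c = qint (2 * x - 4 * int c) * P"
      "qbinom2 (x - int c - 1) d = qint (2 * int c) * P"
      using qbinom2_common[of x d] unfolding Suc by blast
    \<comment> \<open>For \<open>m = 0\<close> the truncated index \<open>2 * m - 1 = 0\<close> is harmless because of the factor \<open>[0]\<close>.\<close>
    have e4: "qint n * coef (2 * m - 1) l (c - 1) a =
        qint n * (qv powi (1 + 2 * int c - 2 * x) * (G * (qint (2 * int c) * P)))"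
    proof (cases m)
      case 0
      then show ?thesis by (simp add: n_def)
    next
      case (Suc k)
      have "coef (2 * k + 1) l d a = qv powi (- a) * coef_monomial a (int d) (x - 1) * qbinom2 (x - 1 - int d - 1) d"
        by (rule coef_odd) (simp add: x_def Suc)
      moreover have "x - 1 - int d - 1 = x - int c - 1" "int d = int c - 1" "c - 1 = d" "2 * m - 1 = 2 * k + 1"
        "- a + (1 + 2 * int c - 2 * x + a) = 1 + 2 * int c - 2 * x"
        by (simp_all add: \<open>c = _\<close> Suc)
      ultimately show ?thesis by (simp only: coef_monomial_shift(6) coef_monomial mult.assoc powi_combine P)
    qed
    have c: "c \<noteq> 0" using Suc by simp
    show ?thesis using arg_cong[OF qint_identity_odd[of n x "int c" a], of "\<lambda>z. z * (G * P)"]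
      unfolding e0 e1 e2 e3 n_def[symmetric] e4 P L if_not_P[OF c] l q[symmetric] unfolding b
      by (simp only: ring_distribs mult_minus_left mult_minus_right minus_minus diff_minus_eq_add
          minus_add_distrib diff_conv_add_uminus mult_ac add_ac)
  qed
qed

section \<open>The expansion\<close>

definition triangle :: "nat \<Rightarrow> (nat \<times> nat) set"
  where "triangle n = {(c, a). 2 * c + a \<le> n}"

lemma finite_triangle [simp]: "finite (triangle n)"
  by (rule finite_subset[of _ "{..n} \<times> {..n}"]) (auto simp: triangle_def)

text \<open>
  Here \<open>b\<close> is the exponent of \<open>F\<close>. The first three terms on the right say from which vectors the
  action of \<open>t\<close> reaches \<open>E\<^bsup>(a)\<^esup>F\<^bsup>(b)\<^esup>1\<^sub>2\<^sub>l\<close>, and the fourth is the correction in the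
  recursion of the \<open>\<iota>\<close>-divided powers.
\<close>

lemma coef_rec:
  assumes "b = int n + 1 - 2 * int c - a"
  shows "qint (int n + 1) * coef (n + 1) l c a =
     qv powi (2 * b - 2 * a + 1 - 2 * l) * qint a * coef n l c (a - 1)
     + qint b * coef n l c a
     - (if c = 0 then 0 else qint (2 * l - 2 * b + a) * coef n l (c - 1) (a + 1))
     - (if c = 0 \<or> odd n then 0 else qint (int n) * coef (n - 1) l (c - 1) a)"
proof (cases "even n")
  case True
  then obtain m where "n = 2 * m" by (elim evenE)
  then show ?thesis using coef_rec_odd[of b m c a l] assms by simp
next
  case False
  then obtain m where "n = 2 * m + 1" by (elim oddE)
  then show ?thesis using coef_rec_even[of b m c a l] assms by (simp add: add_ac)
qed

definition expansion :: "int \<Rightarrow> nat \<Rightarrow> Udot"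
  where "expansion l n = (\<Sum>(c, a)\<in>triangle n. coef n l c (int a) *\<^sub>D pbw (2 * l) a (n - 2 * c - a))"

lemma t_pbw:
  "U_t \<cdot> pbw l a b = (qv powi (2 * int b - 2 * int a - l - 1) * qint (int a + 1)) *\<^sub>D pbw l (Suc a) b
     + qint (int b + 1) *\<^sub>D pbw l a (Suc b)
     - (if a = 0 then 0 else qint (l - 2 * int b + int a - 1) *\<^sub>D pbw l (a - 1) b)"
  by (simp add: U_t_def act_module Echeck_pbw F_pbw)

text \<open>
  The three parts of the action of \<open>t\<close> are reindexed to sums over the index set of order \<open>n + 1\<close>.
  Indices that are not hit carry coefficient zero, and the remaining coefficients are compared by
  \<open>coef_rec\<close>.
\<close>

lemma t_expansion:
  "U_t \<cdot> expansion l n = qint (int n + 1) *\<^sub>D expansion l (n + 1)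
     + (if even n then qint (int n) *\<^sub>D expansion l (n - 1) else 0)"
proof -
  define e where "e c a = pbw (2 * l) a (n + 1 - 2 * c - a)" for c a
  define b where "b c a = int n + 1 - 2 * int c - int a" for c a :: nat
  have b_top: "b c a = 0" if "2 * c + a = n + 1" for c a
    using that by (simp add: b_def)
  have b_lower: "b c a = int (n - 2 * c - a) + 1" if "2 * c + a \<le> n" for c a
    using that by (simp add: b_def of_nat_diff)
  let ?T = "triangle (n + 1)"
  \<comment> \<open>The new index \<open>a = 0\<close> is not reached, but there the factor \<open>[a]\<close> vanishes.\<close>
  have raise_E: "(\<Sum>(c, a)\<in>triangle n. (qv powi (2 * int (n - 2 * c - a) - 2 * int a - 2 * l - 1) * qint (int a + 1) * coef n l c (int a))
        *\<^sub>D pbw (2 * l) (Suc a) (n - 2 * c - a)) =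
     (\<Sum>(c, a)\<in>?T. (qv powi (2 * b c a - 2 * int a + 1 - 2 * l) * qint (int a) * coef n l c (int a - 1)) *\<^sub>D e c a)"
    by (rule sum.reindex_bij_witness_not_neutral[where S' = "{}" and T' = "?T \<inter> {(c, a). a = 0}"
          and i = "\<lambda>(c, a). (c, a - 1)" and j = "\<lambda>(c, a). (c, a + 1)"], simp, simp)
       (auto simp: triangle_def e_def b_def of_nat_diff algebra_simps)
  \<comment> \<open>Likewise the indices with \<open>b = 0\<close>, which are \<open>2c + a = n + 1\<close>, carry the factor \<open>[b] = 0\<close>.\<close>
  have raise_F: "(\<Sum>(c, a)\<in>triangle n. (qint (int (n - 2 * c - a) + 1) * coef n l c (int a)) *\<^sub>D pbw (2 * l) a (Suc (n - 2 * c - a))) =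
     (\<Sum>(c, a)\<in>?T. (qint (b c a) * coef n l c (int a)) *\<^sub>D e c a)"
    by (rule sum.reindex_bij_witness_not_neutral[where S' = "{}" and T' = "?T \<inter> {(c, a). 2 * c + a = n + 1}"
          and i = "\<lambda>x. x" and j = "\<lambda>x. x"], simp, simp)
       (auto simp: triangle_def e_def b_top b_lower Suc_diff_le)
  \<comment> \<open>Lowering \<open>a\<close> while keeping \<open>b\<close> raises \<open>c\<close>. The terms with \<open>a = 0\<close> are zero; the bijection
     sends them to a place with \<open>c = 0\<close>, where the target is zero too.\<close>
  have lower_E: "(\<Sum>(c, a)\<in>triangle n. (if a = 0 then 0 else (qint (2 * l - 2 * int (n - 2 * c - a) + int a - 1) * coef n l c (int a))
        *\<^sub>D pbw (2 * l) (a - 1) (n - 2 * c - a))) =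
     (\<Sum>(c, a)\<in>?T. (if c = 0 then 0 else qint (2 * l - 2 * b c a + int a) * coef n l (c - 1) (int a + 1)) *\<^sub>D e c a)"
    by (rule sum.reindex_bij_witness_not_neutral[where S' = "triangle n \<inter> {(c, a). a = 0}" and T' = "?T \<inter> {(c, a). c = 0}"
          and i = "\<lambda>(c, a). (c - 1, a + 1)" and j = "\<lambda>(c, a). (if a = 0 then 0 else c + 1, a - 1)"], simp, simp)
       (auto simp: triangle_def e_def b_def of_nat_diff algebra_simps)
  have previous: "(if even n then qint (int n) *\<^sub>D expansion l (n - 1) else 0) =
     (\<Sum>(c, a)\<in>?T. (if c = 0 \<or> odd n then 0 else qint (int n) * coef (n - 1) l (c - 1) (int a)) *\<^sub>D e c a)"
  proof (cases "even n \<and> n > 0")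
    case True
    have "(\<Sum>(c, a)\<in>triangle (n - 1). (qint (int n) * coef (n - 1) l c (int a)) *\<^sub>D pbw (2 * l) a (n - 1 - 2 * c - a)) =
       (\<Sum>(c, a)\<in>?T. (if c = 0 then 0 else qint (int n) * coef (n - 1) l (c - 1) (int a)) *\<^sub>D e c a)"
      by (rule sum.reindex_bij_witness_not_neutral[where S' = "{}" and T' = "?T \<inter> {(c, a). c = 0}"
          and i = "\<lambda>(c, a). (c - 1, a)" and j = "\<lambda>(c, a). (c + 1, a)"], simp, simp)
       (use True in \<open>auto simp: triangle_def e_def algebra_simps\<close>)
    with True show ?thesis
      by (simp add: expansion_def Udot.scale_sum_right case_prod_unfold)
  qed (auto simp: case_prod_unfold cong: if_cong)
  have rec: "qv powi (2 * b c a - 2 * int a + 1 - 2 * l) * qint (int a) * coef n l c (int a - 1)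
       + qint (b c a) * coef n l c (int a)
       - (if c = 0 then 0 else qint (2 * l - 2 * b c a + int a) * coef n l (c - 1) (int a + 1)) =
     qint (int n + 1) * coef (n + 1) l c (int a)
       + (if c = 0 \<or> odd n then 0 else qint (int n) * coef (n - 1) l (c - 1) (int a))" for c a
    using coef_rec[of "b c a" n c "int a" l] by (simp add: b_def)
  have expand: "U_t \<cdot> (k *\<^sub>D pbw l a b) =
      (qv powi (2 * int b - 2 * int a - l - 1) * qint (int a + 1) * k) *\<^sub>D pbw l (Suc a) b
     + (qint (int b + 1) * k) *\<^sub>D pbw l a (Suc b)
     - (if a = 0 then 0 else (qint (l - 2 * int b + int a - 1) * k) *\<^sub>D pbw l (a - 1) b)" for k l a b
    by (simp add: act_left_op(2) t_pbw Udot.scale_right_distrib Udot.scale_right_diff_distrib mult_ac)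
  have "U_t \<cdot> expansion l n = 
     (\<Sum>(c, a)\<in>triangle n. (qv powi (2 * int (n - 2 * c - a) - 2 * int a - 2 * l - 1) * qint (int a + 1) * coef n l c (int a))
        *\<^sub>D pbw (2 * l) (Suc a) (n - 2 * c - a)) +
     (\<Sum>(c, a)\<in>triangle n. (qint (int (n - 2 * c - a) + 1) * coef n l c (int a)) *\<^sub>D pbw (2 * l) a (Suc (n - 2 * c - a))) -
     (\<Sum>(c, a)\<in>triangle n. (if a = 0 then 0 else (qint (2 * l - 2 * int (n - 2 * c - a) + int a - 1) * coef n l c (int a))
        *\<^sub>D pbw (2 * l) (a - 1) (n - 2 * c - a)))"
    by (simp only: expansion_def act_sum case_prod_unfold expand sum.distrib sum_subtractf)
  also have "\<dots> = (\<Sum>(c, a)\<in>?T. (qint (int n + 1) * coef (n + 1) l c (int a)) *\<^sub>D e c a) +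
     (\<Sum>(c, a)\<in>?T. (if c = 0 \<or> odd n then 0 else qint (int n) * coef (n - 1) l (c - 1) (int a)) *\<^sub>D e c a)"
    unfolding raise_E raise_F lower_E unfolding sum.distrib[symmetric] sum_subtractf[symmetric] case_prod_unfold
      Udot.scale_left_distrib[symmetric] Udot.scale_left_diff_distrib[symmetric] rec ..
  also have "(\<Sum>(c, a)\<in>?T. (qint (int n + 1) * coef (n + 1) l c (int a)) *\<^sub>D e c a) = qint (int n + 1) *\<^sub>D expansion l (n + 1)"
    by (simp add: expansion_def Udot.scale_sum_right case_prod_unfold e_def)
  finally show ?thesis unfolding previous .
qed

lemma expansion_0: "expansion l 0 = D_one (2 * l)"
proof -
  have "triangle 0 = {(0, 0)}" by (auto simp: triangle_def)
  moreover have "coef 0 l 0 0 = 1" using coef_even[of "- l" 0 0 l 0] by (simp add: coef_monomial_def)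
  ultimately show ?thesis by (simp add: expansion_def pbw_powers act_module)
qed

text \<open>
  Both sides satisfy the same recursion in \<open>n\<close>, and \<open>[k + 1]\<close> is invertible.
\<close>

lemma t_ev_expansion: "t_ev n \<cdot> D_one (2 * l) = expansion l n"
proof (induction n rule: less_induct)
  case (less n)
  show ?case
  proof (cases n)
    case 0
    then show ?thesis by (simp add: act_module expansion_0)
  next
    case (Suc k)
    have "qint (int k + 1) *\<^sub>D (t_ev (k + 1) \<cdot> D_one (2 * l)) = qint (int k + 1) *\<^sub>D expansion l (k + 1)"
    proof -
      have zero: "0 \<cdot> x = 0" for x using act_diff_left[of 0 0 x] by simp
      have "qint (int k + 1) *\<^sub>D (t_ev (k + 1) \<cdot> D_one (2 * l)) =
         U_t \<cdot> (t_ev k \<cdot> D_one (2 * l)) - (if even k then qint (int k) *\<^sub>D (t_ev (k - 1) \<cdot> D_one (2 * l)) else 0)"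
        unfolding act_module(4)[symmetric] t_ev_rec by (simp add: act_diff_left act_module zero)
      also have "t_ev k \<cdot> D_one (2 * l) = expansion l k" using less Suc by simp
      also have "t_ev (k - 1) \<cdot> D_one (2 * l) = expansion l (k - 1)" using less Suc by simp
      finally show ?thesis by (simp add: t_expansion)
    qed
    then show ?thesis using qint_neq_0[of "int k + 1"] Suc by simp
  qed
qed

lemma expansion_sum:
  "expansion l n = (\<Sum>c = 0..n div 2. \<Sum>a = 0..n - 2 * c. coef n l c (int a) *\<^sub>D pbw (2 * l) a (n - 2 * c - a))"
proof -
  have "triangle n = (SIGMA c:{0..n div 2}. {0..n - 2 * c})" by (auto simp: triangle_def)
  then show ?thesis unfolding expansion_def by (simp add: sum.Sigma)
qed

section \<open>Integrality\<close>

text \<open>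
  Since \<open>F\<^bsup>(b)\<^esup>1\<^sub>l\<close> has weight \<open>l - 2b\<close>, the idempotent of that weight may be inserted after
  \<open>E\<^bsup>(a)\<^esup>\<close>, which exhibits the vector as a product of two generators of the integral form.
\<close>

lemma pbw_A_Udot: "pbw l a b \<in> A_Udot"
proof -
  let ?y = "U_Fdiv b \<cdot> D_one l"
  have one: "D_one (l - 2 * int b) * (U_F ^ b \<cdot> D_one l) = U_F ^ b \<cdot> D_one l"
  proof (induction b)
    case 0
    show ?case by (simp add: act_module D_one_one)
  next
    case (Suc b)
    have "U_F \<cdot> (U_F ^ b \<cdot> D_one l) = (U_F \<cdot> D_one (l - 2 * int b)) * (U_F ^ b \<cdot> D_one l)"
      using Suc by (simp flip: act_left_op(3))
    also have "\<dots> = D_one (l - 2 * int b - 2) * \<dots>"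
      by (simp add: act_generators Udot_relations flip: mult.assoc)
    finally have "U_F \<cdot> (U_F ^ b \<cdot> D_one l) = D_one (l - 2 * int b - 2) * (U_F \<cdot> (U_F ^ b \<cdot> D_one l))"
      using Suc by (simp flip: act_left_op(3))
    then show ?case by (simp add: act_module algebra_simps)
  qed
  then have "D_one (l - 2 * int b) * ?y = ?y"
    by (simp add: U_Fdiv_def act_module scale_D_mult_right)
  then have "pbw l a b = (U_Ediv a \<cdot> D_one (l - 2 * int b)) * ?y"
    by (simp add: pbw_def act_module flip: act_left_op(3))
  then show ?thesis by (simp add: A_Udot.intros)
qed

lemma A_Udot_sum:
  assumes "\<And>i. i \<in> I \<Longrightarrow> f i \<in> A_Udot" shows "sum f I \<in> A_Udot"
proof -
  have "0 \<in> A_Udot" using A_Udot.scale[OF laurent_ring_0 A_Udot.one[of 0]] by simp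
  then show ?thesis using assms
    by (induction I rule: infinite_finite_induct) (auto intro: A_Udot.add)
qed

lemma expansion_A_Udot: "expansion l n \<in> A_Udot"
  unfolding expansion_def coef_def Let_def case_prod_unfold
  by (intro A_Udot_sum A_Udot.scale laurent_ring_mult laurent_ring_powi qbinom2_laurent pbw_A_Udot)

lemma t_ev_A_Udot_ev: "t_ev n \<cdot> D_one (2 * l) \<in> A_Udot_ev"
proof -
  have "t_ev n \<cdot> D_one (2 * l) = (\<Sum>k\<in>{l}. (t_ev n \<cdot> D_one (2 * k)) * D_one (2 * k))"
    by (simp add: D_one_one flip: act_left_op(3))
  moreover have "t_ev n \<cdot> D_one (2 * l) \<in> A_Udot"
    by (simp add: t_ev_expansion expansion_A_Udot)
  ultimately show ?thesis unfolding A_Udot_ev_def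
    by (intro CollectI exI[of _ "{l}"] exI[of _ "\<lambda>k. t_ev n \<cdot> D_one (2 * k)"]) simp
qed

theorem proposition2p8:
  shows
    "(\<forall>(m :: nat) (l :: int). m \<ge> 1 \<longrightarrow>
        t_ev (2 * m) \<cdot> D_one (2 * l) =
          (\<Sum>c = 0..m. \<Sum>a = 0..2 * m - 2 * c.
             (qv powi (2 * (int a + int c) * (int m - int a - l) - 2 * int a * int c
                       - binom2 (2 * int c + 1))
              * qbinom2 (int m - int c - int a - l) c)
             *\<^sub>D ((U_Ediv a * U_Fdiv (2 * m - 2 * c - a)) \<cdot> D_one (2 * l)))) \<and>
     (\<forall>(m :: nat) (l :: int). m \<ge> 1 \<longrightarrow>
        t_ev (2 * m - 1) \<cdot> D_one (2 * l) =
          (\<Sum>c = 0..m - 1. \<Sum>a = 0..2 * m - 1 - 2 * c.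
             (qv powi (2 * (int a + int c) * (int m - int a - l) - 2 * int a * int c - int a
                       - binom2 (2 * int c + 1))
              * qbinom2 (int m - int c - int a - l - 1) c)
             *\<^sub>D ((U_Ediv a * U_Fdiv (2 * m - 1 - 2 * c - a)) \<cdot> D_one (2 * l)))) \<and>
     (\<forall>(n :: nat) (l :: int). t_ev n \<cdot> D_one (2 * l) \<in> A_Udot_ev)"
proof (intro conjI allI impI)
  fix m :: nat and l :: int
  have "(2 * m + 1) div 2 = m" "2 * m mod 2 = 0" "2 * m div 2 = m" by simp_all
  then show "t_ev (2 * m) \<cdot> D_one (2 * l) =
          (\<Sum>c = 0..m. \<Sum>a = 0..2 * m - 2 * c.
             (qv powi (2 * (int a + int c) * (int m - int a - l) - 2 * int a * int c
                       - binom2 (2 * int c + 1))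
              * qbinom2 (int m - int c - int a - l) c)
             *\<^sub>D ((U_Ediv a * U_Fdiv (2 * m - 2 * c - a)) \<cdot> D_one (2 * l)))"
    unfolding t_ev_expansion expansion_sum coef_def Let_def pbw_def
    by (simp only: of_nat_0 mult_zero_left diff_0_right)
next
  fix m :: nat and l :: int
  assume "m \<ge> 1"
  then have "(2 * m - 1 + 1) div 2 = m" "(2 * m - 1) mod 2 = 1" "(2 * m - 1) div 2 = m - 1"
    by (cases m; simp)+
  then show "t_ev (2 * m - 1) \<cdot> D_one (2 * l) =
          (\<Sum>c = 0..m - 1. \<Sum>a = 0..2 * m - 1 - 2 * c.
             (qv powi (2 * (int a + int c) * (int m - int a - l) - 2 * int a * int c - int a
                       - binom2 (2 * int c + 1))
              * qbinom2 (int m - int c - int a - l - 1) c)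
             *\<^sub>D ((U_Ediv a * U_Fdiv (2 * m - 1 - 2 * c - a)) \<cdot> D_one (2 * l)))"
    unfolding t_ev_expansion expansion_sum coef_def Let_def pbw_def
    by (simp only: of_nat_1 mult_1_left)
qed (rule t_ev_A_Udot_ev)

end
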